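(* Fix $d\ge 2$. Every set of $n$ points in $\mathbb{R}^d$ with at most $\ell$ cohyperplanar points, where $\ell = O(n^{1/2})$, contains a subset of $\Omega\!\left((n/\log\ell)^{1/d}\right)$ points in general position. That is, $\alpha(n,d,\ell) = \Omega\!\left((n/\log\ell)^{1/d}\right)$ for $\ell = O(\sqrt{n})$.
   Context: A finite set of points in $\mathbb{R}^d$ is in general position if no hyperplane contains more than $d$ of its points; points are cohyperplanar if some hyperplane contains all of them. $\alpha(n,d,\ell)$ denotes the largest integer such that every set of $n$ points in $\mathbb{R}^d$ in which at most $\ell$ points lie in any hyperplane contains a subset of $\alpha(n,d,\ell)$ points in general position. The asymptotic notation is for $n\to\infty$ with $d$ fixed; the implied constants depend only on $d$ and on the constant in $\ell=O(\sqrt n)$. *)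

theory Defs
  imports "HOL-Analysis.Analysis"
begin

definition hyperplane :: "'a::euclidean_space set \<Rightarrow> bool" where
  "hyperplane H \<longleftrightarrow> (\<exists>a b. a \<noteq> 0 \<and> H = {x. a \<bullet> x = b})"

definition general_position :: "(real ^ 'd) set \<Rightarrow> bool" where
  "general_position S \<longleftrightarrow>
     finite S \<and> (\<forall>H. hyperplane H \<longrightarrow> card (S \<inter> H) \<le> CARD('d))"

definition at_most_cohyperplanar :: "nat \<Rightarrow> (real ^ 'd) set \<Rightarrow> bool" where
  "at_most_cohyperplanar l P \<longleftrightarrow> (\<forall>H. hyperplane H \<longrightarrow> card (P \<inter> H) \<le> l)"

text \<open>The dimension is passed as a type. For \<open>n \<ge> CARD('d)\<close> the maximum exists exactly when
  \<open>l \<ge> CARD('d)\<close>: any \<open>CARD('d)\<close> points lie on a common hyperplane, so for smaller \<open>l\<close> no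
  point set is admissible, every \<open>k\<close> qualifies vacuously, and the value below is unspecified.\<close>

definition alpha :: "nat \<Rightarrow> 'd::finite itself \<Rightarrow> nat \<Rightarrow> nat" where
  "alpha n (_ :: 'd itself) l =
     (GREATEST k. \<forall>P :: (real ^ 'd) set.
        finite P \<and> card P = n \<and> at_most_cohyperplanar l P \<longrightarrow>
        (\<exists>S\<subseteq>P. card S = k \<and> general_position S))"

end

theory Submission
  imports Defs
begin

text \<open>
  A random subset of the points, with one point deleted from each of its cohyperplanar
  \<open>(d + 1)\<close>-subsets, is in general position, and it is large enough once \<open>P\<close> has only
  \<open>O(n\<^sup>d log \<ell>)\<close> such \<open>(d + 1)\<close>-subsets. Replacing \<open>p\<close> by \<open>(1, p)\<close> makes affine flats linear
  subspaces. Call a flat nondegenerate if each proper subflat carries only a small fraction of its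
  points. By a bound of Elekes and Toth, at most \<open>O(n\<^sup>m / s\<^sup>m\<^sup>+\<^sup>1 + n\<^sup>m\<^sup>-\<^sup>1 / s\<^sup>m\<^sup>-\<^sup>1)\<close> nondegenerate flats
  of rank \<open>m\<close> contain \<open>s\<close> points or more. Every flat contains a nondegenerate one with a positive fraction of
  its points, so summing over the dyadic sizes of the latter counts the dependent tuples; each of
  the \<open>log \<ell>\<close> scales contributes \<open>O(n\<^sup>d)\<close>, and \<open>\<ell> = O(\<surd>n)\<close> controls the second term.

  The Elekes-Toth bound is proved by induction on \<open>m\<close>: a nondegenerate flat of rank \<open>m\<close> contains
  many independent \<open>(m - 1)\<close>-tuples that span a flat with boundedly many points (this uses the
  bound for smaller ranks), and projecting from \<open>m - 2\<close> of their members to a plane reduces the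
  count to the Szemeredi-Trotter theorem. That theorem follows, as in Szekely's proof, from the
  crossing inequality, which for straight-line graphs only needs that a plane graph on \<open>v\<close>
  vertices has at most \<open>3 v\<close> edges: every edge is the topmost one at its left end, or
  at its right end, or lies directly below some vertex.
\<close>

section \<open>Random subsets\<close>

text \<open>Nondegeneracy is what makes rich flats countable. With half of the points on one line,
  about n/2 planes through it have n/2 points each, whereas the bound for rank 3 and s = n/2 allows
  only O(1). Passing from a span of rank R to a nondegenerate subflat of rank j costs a constant
  factor in size, and the lost rank reappears as R - j freely chosen entries. These exactly offset
  the dependence of the flat bound on j, so every j leads to the same estimate: up to constants,
  (d+1)-tuples of rank R contribute s^(d-R) (n^R + n^(R-1) s^2) at scale s. As s is at most n, the
  first part is at most n^d at each scale, and the number of scales is the source of the logarithm.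
  The second part is at most n^(d-1) l s; it sums geometrically to O(n^(d-1) l^2), which is O(n^d)
  precisely for l = O(sqrt n). With M n^d log l bad sets, p proportional to (n / log l)^(1/d) / n
  balances the expected size n p against the expected loss M n^d log l p^(d+1).\<close>

definition expect :: "'a set \<Rightarrow> real \<Rightarrow> ('a set \<Rightarrow> real) \<Rightarrow> real" where
  "expect V p f = (\<Sum>S\<in>Pow V. p ^ card S * (1 - p) ^ card (V - S) * f S)"

text \<open>The law keeps each point independently with probability \<open>p\<close>. Replacing the
  weight \<open>1 - p\<close> of leaving out a point by 0 on \<open>A\<close> kills exactly the
  terms whose \<open>S\<close> misses a point of \<open>A\<close>, and makes the sum factor into a
  product.\<close>

lemma expect_superset:
  assumes "finite V" "A \<subseteq> V"
  shows "expect V p (\<lambda>S. of_bool (A \<subseteq> S)) = p ^ card A"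
proof -
  have "p ^ card A = (\<Prod>x\<in>V. p + (if x \<in> A then 0 else 1 - p))"
  proof -
    have "(\<Prod>x\<in>V. p + (if x \<in> A then 0 else 1 - p)) = (\<Prod>x\<in>V. if x \<in> A then p else 1)"
      by (rule prod.cong) auto
    also have "\<dots> = p ^ card (V \<inter> A)"
      using assms(1) by (simp add: prod.If_cases)
    finally show ?thesis using assms(2) by (simp add: Int_absorb1)
  qed
  also have "\<dots> = (\<Sum>S\<in>Pow V. (\<Prod>x\<in>S. p) * (\<Prod>x\<in>V - S. if x \<in> A then 0 else 1 - p))"
    by (rule prod_add[OF assms(1)])
  also have "\<dots> = expect V p (\<lambda>S. of_bool (A \<subseteq> S))"
    unfolding expect_def
  proof (rule sum.cong)
    fix S assume S: "S \<in> Pow V"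
    have "(\<Prod>x\<in>V - S. if x \<in> A then 0 else 1 - p) = (1 - p) ^ card (V - S) * of_bool (A \<subseteq> S)"
    proof (cases "A \<subseteq> S")
      case True
      have "(\<Prod>x\<in>V - S. if x \<in> A then 0 else 1 - p) = (\<Prod>x\<in>V - S. 1 - p)"
        by (rule prod.cong) (use True in auto)
      with True show ?thesis by simp
    next
      case False
      then obtain x where "x \<in> A" "x \<notin> S" by auto
      then have "(\<Prod>x\<in>V - S. if x \<in> A then 0 else 1 - p) = 0"
        using assms by (intro prod_zero) auto
      with False show ?thesis by simp
    qed
    then show "(\<Prod>x\<in>S. p) * (\<Prod>x\<in>V - S. if x \<in> A then 0 else 1 - p) =
      p ^ card S * (1 - p) ^ card (V - S) * of_bool (A \<subseteq> S)"
      by simp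
  qed simp
  finally show ?thesis ..
qed

lemma expect_sum: "expect V p (\<lambda>S. \<Sum>i\<in>I. f i S) = (\<Sum>i\<in>I. expect V p (f i))"
  unfolding expect_def by (simp add: sum_distrib_left sum.swap[of _ I])

lemma expect_mult: "expect V p (\<lambda>S. c * f S) = c * expect V p f"
  unfolding expect_def by (simp add: sum_distrib_left mult.left_commute)

lemma expect_add: "expect V p (\<lambda>S. f S + g S) = expect V p f + expect V p g"
  unfolding expect_def by (simp add: algebra_simps sum.distrib)

lemma expect_mono:
  assumes "0 \<le> p" "p \<le> 1" "\<And>S. S \<subseteq> V \<Longrightarrow> f S \<le> g S"
  shows "expect V p f \<le> expect V p g"
  unfolding expect_def using assms by (intro sum_mono mult_left_mono) auto

lemma expect_card_superset:
  assumes "finite V" "finite I" "\<And>i. i \<in> I \<Longrightarrow> A i \<subseteq> V \<and> card (A i) = k"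
  shows "expect V p (\<lambda>S. real (card {i\<in>I. A i \<subseteq> S})) = real (card I) * p ^ k"
proof -
  have eq: "real (card {i\<in>I. A i \<subseteq> S}) = (\<Sum>i\<in>I. of_bool (A i \<subseteq> S))" for S
    using assms(2) by (simp add: of_bool_def sum.If_cases Int_def)
  show ?thesis
    unfolding eq expect_sum using assms by (simp add: expect_superset)
qed

lemma expect_card:
  assumes "finite V"
  shows "expect V p (\<lambda>S. real (card S)) = real (card V) * p"
proof -
  have "expect V p (\<lambda>S. real (card S)) = expect V p (\<lambda>S. real (card {x\<in>V. {x} \<subseteq> S}))"
    unfolding expect_def by (intro sum.cong refl) (auto intro!: arg_cong[where f = card])
  then show ?thesis
    using expect_card_superset[OF assms assms, of "\<lambda>x. {x}" 1 p] by simp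
qed

section \<open>Plane straight-line graphs\<close>

text \<open>A negative value at \<open>z\<close> would put the root strictly between
  \<open>z\<close> and \<open>x1\<close>, hence inside the interval. The conclusion is weak because
  the root may be an end of it, as for two edges with a common vertex.\<close>

lemma affine_sign:
  fixes u v x1 a b :: real
  assumes nz: "\<And>x. a < x \<Longrightarrow> x < b \<Longrightarrow> u * x + v \<noteq> 0"
    and x1: "a \<le> x1" "x1 \<le> b" "0 < u * x1 + v" and z: "a \<le> z" "z \<le> b"
  shows "0 \<le> u * z + v"
proof (rule ccontr)
  assume neg: "\<not> 0 \<le> u * z + v"
  define x0 where "x0 = - v / u"
  have "u \<noteq> 0" using neg x1(3) by auto
  then have zero: "u * x0 + v = 0" unfolding x0_def by simp
  have "min z x1 < x0 \<and> x0 < max z x1"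
  proof (cases "u > 0")
    case True
    have "u * z < u * x0" "u * x0 < u * x1" using zero neg x1(3) by linarith+
    then show ?thesis using True by (simp add: min_less_iff_disj less_max_iff_disj)
  next
    case False
    then have u: "u < 0" using \<open>u \<noteq> 0\<close> by simp
    have "u * z < u * x0" "u * x0 < u * x1" using zero neg x1(3) by linarith+
    then show ?thesis using u by (simp add: min_less_iff_disj less_max_iff_disj)
  qed
  then have "a < x0" "x0 < b" using x1 z by linarith+
  then show False using nz zero by blast
qed

text \<open>Vertices have distinct abscissae, so a vertex is encoded by its abscissa alone, and its ordinate
  is given by \<open>h\<close>. The edge \<open>e\<close> lies on the line with slope \<open>\<alpha> e\<close> and intercept \<open>\<beta> e\<close>.\<close>

locale plane_graph =
  fixes V :: "real set" and h :: "real \<Rightarrow> real" and E :: "(real \<times> real) set"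
    and \<alpha> \<beta> :: "real \<times> real \<Rightarrow> real"
  assumes fin: "finite V"
    and edge: "\<And>l r. (l, r) \<in> E \<Longrightarrow> l \<in> V \<and> r \<in> V \<and> l < r"
    and left: "\<And>l r. (l, r) \<in> E \<Longrightarrow> \<alpha> (l, r) * l + \<beta> (l, r) = h l"
    and right: "\<And>l r. (l, r) \<in> E \<Longrightarrow> \<alpha> (l, r) * r + \<beta> (l, r) = h r"
    and no_vertex: "\<And>l r w. (l, r) \<in> E \<Longrightarrow> w \<in> V \<Longrightarrow> l < w \<Longrightarrow> w < r \<Longrightarrow>
       \<alpha> (l, r) * w + \<beta> (l, r) \<noteq> h w"
    and no_cross: "\<And>l r l' r' x. (l, r) \<in> E \<Longrightarrow> (l', r') \<in> E \<Longrightarrow> (l, r) \<noteq> (l', r') \<Longrightarrow>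
       l < x \<Longrightarrow> l' < x \<Longrightarrow> x < r \<Longrightarrow> x < r' \<Longrightarrow>
       \<alpha> (l, r) * x + \<beta> (l, r) \<noteq> \<alpha> (l', r') * x + \<beta> (l', r')"
begin

definition y :: "real \<times> real \<Rightarrow> real \<Rightarrow> real" where
  "y e x = \<alpha> e * x + \<beta> e"

text \<open>\<open>e\<close> is the first edge met when going straight down from the vertex
  \<open>w\<close>. Edges that merely end at \<open>w\<close> do not count.\<close>

definition seen :: "real \<times> real \<Rightarrow> real \<Rightarrow> bool" where
  "seen e w \<longleftrightarrow> w \<in> V \<and> fst e < w \<and> w < snd e \<and> y e w < h w \<and>
     (\<forall>f\<in>E. fst f < w \<and> w < snd f \<and> y e w < y f w \<longrightarrow> h w \<le> y f w)"

definition top_right :: "real \<times> real \<Rightarrow> bool" where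
  "top_right e \<longleftrightarrow> (\<forall>f\<in>E. fst f = fst e \<longrightarrow> \<alpha> f \<le> \<alpha> e)"

text \<open>To the left of a common right end, the highest edge is the one of least slope.\<close>

definition top_left :: "real \<times> real \<Rightarrow> bool" where
  "top_left e \<longleftrightarrow> (\<forall>f\<in>E. snd f = snd e \<longrightarrow> \<alpha> e \<le> \<alpha> f)"

lemma finite_E: "finite E"
  by (rule finite_subset[of _ "V \<times> V"]) (use edge fin in auto)

text \<open>The difference of the two lines has no zero inside the common range, so
  \<open>affine_sign\<close> applies to it.\<close>

lemma keep_above:
  assumes "e \<in> E" "f \<in> E" "y e w < y f w"
    and "max (fst e) (fst f) \<le> w" "w \<le> min (snd e) (snd f)"
    and "max (fst e) (fst f) \<le> z" "z \<le> min (snd e) (snd f)"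
  shows "y e z \<le> y f z"
proof -
  have "e \<noteq> f" using assms(3) by auto
  have "0 \<le> (\<alpha> f - \<alpha> e) * z + (\<beta> f - \<beta> e)"
  proof (rule affine_sign)
    fix x assume "max (fst e) (fst f) < x" "x < min (snd e) (snd f)"
    then have "\<alpha> e * x + \<beta> e \<noteq> \<alpha> f * x + \<beta> f"
      using no_cross[of "fst e" "snd e" "fst f" "snd f" x] assms(1,2) \<open>e \<noteq> f\<close> by simp
    then show "(\<alpha> f - \<alpha> e) * x + (\<beta> f - \<beta> e) \<noteq> 0" by (simp add: algebra_simps)
  next
    show "0 < (\<alpha> f - \<alpha> e) * w + (\<beta> f - \<beta> e)"
      using assms(3) by (simp add: y_def algebra_simps)
  qed (use assms in auto)
  then show ?thesis by (simp add: y_def algebra_simps)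
qed

text \<open>The leftmost vertex \<open>w\<close> in the region between \<open>e\<close> and the next edge \<open>g\<close> is directly above \<open>e\<close>: an
  edge passing between \<open>e\<close> and \<open>w\<close> would have its left end in the same region.\<close>

lemma seen_by_next_right:
  assumes e: "(u, v) \<in> E" and g: "(u, g2) \<in> E" and lt: "g2 < v"
    and sl: "\<alpha> (u, v) < \<alpha> (u, g2)"
    and next_edge: "\<And>f2. (u, f2) \<in> E \<Longrightarrow> \<alpha> (u, v) < \<alpha> (u, f2) \<Longrightarrow> \<alpha> (u, g2) \<le> \<alpha> (u, f2)"
  shows "\<exists>w. seen (u, v) w"
proof -
  let ?e = "(u, v)" and ?g = "(u, g2)"
  have uv: "u \<in> V" "u < v" and ug: "u < g2" "g2 \<in> V" using edge[OF e] edge[OF g] by auto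
  have at_u: "y ?e u = h u" "y ?g u = h u" using left[OF e] left[OF g] by (auto simp: y_def)
  have slope_above: "y f1 x < y f2 x \<longleftrightarrow> \<alpha> f1 < \<alpha> f2"
    if "y f1 u = y f2 u" "u < x" for f1 f2 x
  proof -
    have "y f2 x - y f1 x = (\<alpha> f2 - \<alpha> f1) * (x - u)" using that(1)
      by (simp add: y_def algebra_simps)
    then show ?thesis using that(2)
      by (smt (verit) mult_pos_pos zero_less_mult_iff)
  qed
  define W where "W = {w\<in>V. u < w \<and> w \<le> g2 \<and> y ?e w < h w \<and> h w \<le> y ?g w}"
  have "g2 \<in> W"
    using ug slope_above[of ?e ?g g2] sl at_u right[OF g] by (auto simp: W_def y_def)
  moreover have finW: "finite W" using fin by (simp add: W_def)
  ultimately have w: "Min W \<in> W" by (intro Min_in) auto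
  define w where "w = Min W"
  have wW: "w \<in> V" "u < w" "w \<le> g2" "y ?e w < h w" "h w \<le> y ?g w"
    using w by (auto simp: W_def w_def)
  have "seen ?e w"
    unfolding seen_def
  proof (intro conjI ballI impI)
    fix f assume f: "f \<in> E" "fst f < w \<and> w < snd f \<and> y ?e w < y f w"
    obtain a b where ab: "f = (a, b)" by (cases f)
    have abE: "(a, b) \<in> E" "a \<in> V" using f(1) edge ab by auto
    show "h w \<le> y f w"
    proof (rule ccontr)
      assume "\<not> h w \<le> y f w"
      then have below: "y f w < y ?g w" using wW by simp
      have le_g: "y f z \<le> y ?g z" if "max a u \<le> z" "z \<le> w" for z
        by (rule keep_above[OF f(1) g below]) (use that f ab wW lt in auto)
      have ge_e: "y ?e z \<le> y f z" if "max a u \<le> z" "z \<le> w" for z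
        by (rule keep_above[OF e f(1), of w]) (use that f ab wW lt in auto)
      consider "a < u" | "a = u" | "u < a" by linarith
      then show False
      proof cases
        case 1
        \<comment> \<open>\<open>e\<close> and \<open>g\<close> meet at \<open>u\<close>, so
          \<open>f\<close>, squeezed between them, runs through the vertex \<open>u\<close>.\<close>
        then have "y f u = h u" using le_g[of u] ge_e[of u] at_u wW by auto
        then show False using no_vertex[OF abE(1) uv(1) 1] f(2) ab wW by (simp add: y_def)
      next
        case 2
        then have "y f u = h u" using left[OF abE(1)] ab by (simp add: y_def)
        \<comment> \<open>\<open>f\<close> leaves \<open>u\<close> strictly between \<open>e\<close>
          and \<open>g\<close>, against the choice of \<open>g\<close> as the next edge above
          \<open>e\<close>.\<close>
        then have "\<alpha> ?e < \<alpha> f" "\<alpha> f < \<alpha> ?g"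
          using slope_above[of ?e f w] slope_above[of f ?g w] f(2) below at_u wW by auto
        then show False using next_edge[of b] abE 2 ab by auto
      next
        case 3
        have fa: "y f a = h a" using left[OF abE(1)] ab by (simp add: y_def)
        have "a < w" using f ab by simp
        then have "y ?e a \<le> h a" "h a \<le> y ?g a" using le_g[of a] ge_e[of a] 3 fa by auto
        moreover have "y ?e a \<noteq> h a"
          using no_vertex[OF e abE(2) 3] \<open>a < w\<close> wW lt by (simp add: y_def)
        ultimately have "a \<in> W" using 3 \<open>a < w\<close> wW abE by (simp add: W_def)
        then have "w \<le> a" unfolding w_def by (rule Min_le[OF finW])
        then show False using \<open>a < w\<close> by simp
      qed
    qed
  qed (use wW lt in auto)
  then show ?thesis ..
qed

end

text \<open>Reflection in the vertical axis swaps left and right ends, negates slopes, and preserves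
  what lies above what. It turns \<open>seen_by_next_right\<close> into
  \<open>seen_by_next_left\<close>.\<close>

lemma (in plane_graph) mirror:
  "plane_graph (uminus ` V) (\<lambda>x. h (- x)) ((\<lambda>(l, r). (- r, - l)) ` E)
    (\<lambda>(l, r). - \<alpha> (- r, - l)) (\<lambda>(l, r). \<beta> (- r, - l))"
proof
  fix l r l' r' x
  assume *: "(l, r) \<in> (\<lambda>(l, r). (- r, - l)) ` E" "(l', r') \<in> (\<lambda>(l, r). (- r, - l)) ` E"
    "(l, r) \<noteq> (l', r')" "l < x" "l' < x" "x < r" "x < r'"
  then have "(-r, -l) \<in> E" "(-r', -l') \<in> E" by auto
  moreover have "(-r, -l) \<noteq> (-r', -l')" using *(3) by auto
  moreover have "- r < - x" "- r' < - x" "- x < - l" "- x < - l'" using *(4-7) by auto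
  ultimately have "\<alpha> (- r, - l) * (- x) + \<beta> (- r, - l) \<noteq> \<alpha> (- r', - l') * (- x) + \<beta> (- r', - l')"
    by (rule no_cross)
  then show
    "(case (l, r) of (l, r) \<Rightarrow> - \<alpha> (- r, - l)) * x + (case (l, r) of (l, r) \<Rightarrow> \<beta> (- r, - l)) \<noteq>
     (case (l', r') of (l, r) \<Rightarrow> - \<alpha> (- r, - l)) * x + (case (l', r') of (l, r) \<Rightarrow> \<beta> (- r, - l))"
    by simp
next
  fix l r w
  assume *: "(l, r) \<in> (\<lambda>(l, r). (- r, - l)) ` E" "w \<in> uminus ` V" "l < w" "w < r"
  then have "(-r, -l) \<in> E" "- w \<in> V" by auto
  moreover have "- r < - w" "- w < - l" using *(3,4) by auto
  ultimately have "\<alpha> (- r, - l) * (- w) + \<beta> (- r, - l) \<noteq> h (- w)"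
    by (rule no_vertex)
  then show "(case (l, r) of (l, r) \<Rightarrow> - \<alpha> (- r, - l)) * w +
     (case (l, r) of (l, r) \<Rightarrow> \<beta> (- r, - l)) \<noteq> h (- w)"
    by simp
next
  show "finite (uminus ` V)" using fin by simp
next
  fix l r assume "(l, r) \<in> (\<lambda>(l, r). (- r, - l)) ` E"
  then have *: "(-r, -l) \<in> E" by auto
  show "l \<in> uminus ` V \<and> r \<in> uminus ` V \<and> l < r"
    using edge[OF *] by (auto intro: rev_image_eqI)
  show "(case (l, r) of (l, r) \<Rightarrow> - \<alpha> (- r, - l)) * l + (case (l, r) of (l, r) \<Rightarrow> \<beta> (- r, - l)) = h (- l)"
    using right[OF *] by simp
  show "(case (l, r) of (l, r) \<Rightarrow> - \<alpha> (- r, - l)) * r + (case (l, r) of (l, r) \<Rightarrow> \<beta> (- r, - l)) = h (- r)"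
    using left[OF *] by simp
qed

context plane_graph
begin

lemma seen_by_next_left:
  assumes e: "(u, v) \<in> E" and g: "(g1, v) \<in> E" and lt: "u < g1"
    and sl: "\<alpha> (g1, v) < \<alpha> (u, v)"
    and next_edge: "\<And>f1. (f1, v) \<in> E \<Longrightarrow> \<alpha> (f1, v) < \<alpha> (u, v) \<Longrightarrow> \<alpha> (f1, v) \<le> \<alpha> (g1, v)"
  shows "\<exists>w. seen (u, v) w"
proof -
  interpret m: plane_graph "uminus ` V" "\<lambda>x. h (- x)" "(\<lambda>(l, r). (- r, - l)) ` E"
    "\<lambda>(l, r). - \<alpha> (- r, - l)" "\<lambda>(l, r). \<beta> (- r, - l)"
    by (rule mirror)
  have mem: "(l, r) \<in> (\<lambda>(l, r). (- r, - l)) ` E \<longleftrightarrow> (- r, - l) \<in> E" for l r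
    by force
  have "\<exists>w. m.seen (- v, - u) w"
    by (rule m.seen_by_next_right[where ?g2.0 = "- g1"]) (use assms in \<open>auto simp: mem\<close>)
  then obtain w where w: "m.seen (- v, - u) w" ..
  have my: "m.y (l, r) x = y (- r, - l) (- x)" for l r x by (simp add: m.y_def y_def)
  have "seen (u, v) (- w)"
    unfolding seen_def
  proof (intro conjI ballI impI)
    fix f assume f: "f \<in> E" "fst f < - w \<and> - w < snd f \<and> y (u, v) (- w) < y f (- w)"
    then have "(- snd f, - fst f) \<in> (\<lambda>(l, r). (- r, - l)) ` E" by (simp add: mem)
    with w f show "h (- w) \<le> y f (- w)"
      unfolding m.seen_def by (force simp: my)
  qed (use w in \<open>auto simp: m.seen_def my\<close>)
  then show ?thesis ..
qed

text \<open>Otherwise there is a next edge \<open>g\<close> above \<open>e\<close> at the left end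
  \<open>u\<close>, and a next edge \<open>k\<close> above \<open>e\<close> at the right end
  \<open>v\<close>. If one of them stops within the range of \<open>e\<close>, some vertex sees
  \<open>e\<close>. If both overshoot, then \<open>k\<close> is above \<open>g\<close> at
  \<open>u\<close> and below it at \<open>v\<close>, so the two cross.\<close>

lemma edge_cases:
  assumes "e \<in> E"
  shows "top_right e \<or> top_left e \<or> (\<exists>w. seen e w)"
proof (rule ccontr)
  assume contra: "\<not> ?thesis"
  obtain u v where uv: "e = (u, v)" by (cases e)
  have e: "(u, v) \<in> E" using assms uv by simp
  define R where "R = {f\<in>E. fst f = u \<and> \<alpha> e < \<alpha> f}"
  define L where "L = {f\<in>E. snd f = v \<and> \<alpha> f < \<alpha> e}"
  have finRL: "finite R" "finite L" by (auto simp: R_def L_def finite_E)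
  have "R \<noteq> {}" using contra uv unfolding R_def top_right_def by force
  define g where "g = arg_min_on \<alpha> R"
  have gR: "g \<in> R" "\<And>f. f \<in> R \<Longrightarrow> \<alpha> g \<le> \<alpha> f"
    using arg_min_if_finite[OF finRL(1) \<open>R \<noteq> {}\<close>, of \<alpha>] unfolding g_def by fastforce+
  have "L \<noteq> {}" using contra uv unfolding L_def top_left_def by force
  define k where "k = arg_min_on (\<lambda>f. - \<alpha> f) L"
  have kL: "k \<in> L" "\<And>f. f \<in> L \<Longrightarrow> \<alpha> f \<le> \<alpha> k"
    using arg_min_if_finite[OF finRL(2) \<open>L \<noteq> {}\<close>, of "\<lambda>f. - \<alpha> f"] unfolding k_def by fastforce+
  obtain g2 where g2: "g = (u, g2)" using gR by (cases g) (auto simp: R_def)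
  obtain k1 where k1: "k = (k1, v)" using kL by (cases k) (auto simp: L_def)
  have g: "(u, g2) \<in> E" "\<alpha> (u, v) < \<alpha> (u, g2)" and k: "(k1, v) \<in> E" "\<alpha> (k1, v) < \<alpha> (u, v)"
    using gR kL g2 k1 uv by (auto simp: R_def L_def)
  have "\<not> g2 < v"
  proof
    assume "g2 < v"
    from seen_by_next_right[OF e g(1) this g(2)] gR(2) uv g2 contra show False
      by (force simp: R_def)
  qed
  moreover have "g2 \<noteq> v" using g by auto
  ultimately have g2v: "v < g2" by simp
  have "\<not> u < k1"
  proof
    assume "u < k1"
    from seen_by_next_left[OF e k(1) this k(2)] kL(2) uv k1 contra show False
      by (force simp: L_def)
  qed
  moreover have "k1 \<noteq> u" using k by auto
  ultimately have k1u: "k1 < u" by simp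
  have luv: "u < v" using edge[OF e] by simp
  have "y (k1, v) v < y (u, g2) v"
  proof -
    have "y (u, g2) v - y (u, v) v = (\<alpha> (u, g2) - \<alpha> (u, v)) * (v - u)"
      using left[OF e] left[OF g(1)] by (simp add: y_def algebra_simps)
    also have "\<dots> > 0" using g(2) luv by simp
    finally show ?thesis using right[OF e] right[OF k(1)] by (simp add: y_def)
  qed
  then have "y (k1, v) u \<le> y (u, g2) u"
    using keep_above[OF k(1) g(1), of v u] k1u g2v luv by simp
  moreover have "y (k1, v) u > y (u, g2) u"
  proof -
    have "y (k1, v) u - y (u, v) u = (\<alpha> (u, v) - \<alpha> (k1, v)) * (v - u)"
      using right[OF e] right[OF k(1)] by (simp add: y_def algebra_simps)
    also have "\<dots> > 0" using k(2) luv by simp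
    finally show ?thesis using left[OF e] left[OF g(1)] by (simp add: y_def)
  qed
  ultimately show False by simp
qed

lemma fst_less_snd: "e \<in> E \<Longrightarrow> fst e < snd e"
  using edge[of "fst e" "snd e"] by simp

lemma at_left: "e \<in> E \<Longrightarrow> \<alpha> e * fst e + \<beta> e = h (fst e)"
  using left[of "fst e" "snd e"] by simp

lemma at_right: "e \<in> E \<Longrightarrow> \<alpha> e * snd e + \<beta> e = h (snd e)"
  using right[of "fst e" "snd e"] by simp

lemma same_line_eq:
  assumes "e \<in> E" "f \<in> E" "fst e < x" "fst f < x" "x < snd e" "x < snd f" "y e x = y f x"
  shows "e = f"
  using no_cross[of "fst e" "snd e" "fst f" "snd f" x] assms by (auto simp: y_def)

lemma inj_top_right: "inj_on fst {e\<in>E. top_right e}"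
proof (rule inj_onI)
  fix e f assume *: "e \<in> {e\<in>E. top_right e}" "f \<in> {e\<in>E. top_right e}" "fst e = fst f"
  have "\<alpha> e = \<alpha> f" using * unfolding top_right_def by fastforce
  moreover have "\<beta> e = \<beta> f"
    using at_left[of e] at_left[of f] * calculation by simp
  moreover obtain x where "fst e < x" "x < min (snd e) (snd f)"
    using dense[of "fst e" "min (snd e) (snd f)"] fst_less_snd[of e] fst_less_snd[of f] * by auto
  ultimately show "e = f" using same_line_eq[of e f x] * by (simp add: y_def)
qed

lemma inj_top_left: "inj_on snd {e\<in>E. top_left e}"
proof (rule inj_onI)
  fix e f assume *: "e \<in> {e\<in>E. top_left e}" "f \<in> {e\<in>E. top_left e}" "snd e = snd f"
  have "\<alpha> e = \<alpha> f" using * unfolding top_left_def by fastforce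
  moreover have "\<beta> e = \<beta> f"
    using at_right[of e] at_right[of f] * calculation by simp
  moreover obtain x where "max (fst e) (fst f) < x" "x < snd e"
    using dense[of "max (fst e) (fst f)" "snd e"] fst_less_snd[of e] fst_less_snd[of f] * by auto
  ultimately show "e = f" using same_line_eq[of e f x] * by (simp add: y_def)
qed

text \<open>Two edges seen from the same vertex have the same height there, so
  \<open>no_cross\<close> identifies them: each vertex is charged at most once.\<close>

lemma card_seen: "card {e\<in>E. \<exists>w. seen e w} \<le> card V"
proof (rule card_inj_on_le)
  let ?w = "\<lambda>e. SOME w. seen e w"
  have w: "seen e (?w e)" if "e \<in> {e\<in>E. \<exists>w. seen e w}" for e
    using that by (auto intro: someI_ex)
  show "?w ` {e\<in>E. \<exists>w. seen e w} \<subseteq> V" using w by (auto simp: seen_def)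
  show "inj_on ?w {e\<in>E. \<exists>w. seen e w}"
  proof (rule inj_onI)
    fix e f assume *: "e \<in> {e\<in>E. \<exists>w. seen e w}" "f \<in> {e\<in>E. \<exists>w. seen e w}" "?w e = ?w f"
    have s: "seen e (?w e)" "seen f (?w e)" using w[OF *(1)] w[OF *(2)] *(3) by auto
    have "y e (?w e) = y f (?w e)"
    proof (rule antisym)
      show "y f (?w e) \<le> y e (?w e)"
        using s *(2) unfolding seen_def by (smt (verit) mem_Collect_eq)
      show "y e (?w e) \<le> y f (?w e)"
        using s *(1) unfolding seen_def by (smt (verit) mem_Collect_eq)
    qed
    then show "e = f" using same_line_eq[of e f "?w e"] s * by (simp add: seen_def)
  qed
qed (fact fin)

lemma card_edges: "card E \<le> 3 * card V"
proof -
  let ?R = "{e\<in>E. top_right e}" and ?L = "{e\<in>E. top_left e}" and ?S = "{e\<in>E. \<exists>w. seen e w}"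
  have "card ?R \<le> card V" by (rule card_inj_on_le[OF inj_top_right]) (use edge fin in auto)
  moreover have "card ?L \<le> card V" by (rule card_inj_on_le[OF inj_top_left]) (use edge fin in auto)
  moreover have "card E \<le> card ?R + card ?L + card ?S"
  proof -
    have "card E \<le> card (?R \<union> ?L \<union> ?S)"
      by (rule card_mono) (use finite_E edge_cases in auto)
    also have "\<dots> \<le> card ?R + card ?L + card ?S"
      using card_Un_le[of "?R \<union> ?L" ?S] card_Un_le[of ?R ?L] by linarith
    finally show ?thesis .
  qed
  ultimately show ?thesis using card_seen by linarith
qed

end

section \<open>The crossing inequality and the Szemeredi-Trotter theorem\<close>

text \<open>The points form the graph of \<open>h\<close> over \<open>X\<close>, and a line is the
  pair of its slope and intercept. Distinct abscissae and the absence of vertical lines are arranged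
  later by a generic projection.\<close>

locale point_lines =
  fixes X :: "real set" and h :: "real \<Rightarrow> real" and \<Lambda> :: "(real \<times> real) set"
  assumes finX: "finite X" and fin\<Lambda>: "finite \<Lambda>"
begin

definition on_line :: "real \<times> real \<Rightarrow> real set" where
  "on_line L = {x\<in>X. h x = fst L * x + snd L}"

definition slope :: "real \<times> real \<Rightarrow> real" where
  "slope e = (h (snd e) - h (fst e)) / (snd e - fst e)"

definition icpt :: "real \<times> real \<Rightarrow> real" where
  "icpt e = h (fst e) - slope e * fst e"

definition line :: "real \<times> real \<Rightarrow> real \<times> real" where
  "line e = (slope e, icpt e)"

definition edges :: "(real \<times> real) set" where
  "edges = {(l, r). l \<in> X \<and> r \<in> X \<and> l < r \<and> line (l, r) \<in> \<Lambda> \<and>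
     (\<forall>z\<in>X. l < z \<and> z < r \<longrightarrow> h z \<noteq> slope (l, r) * z + icpt (l, r))}"

text \<open>Ordered pairs, so each geometric crossing occurs twice; the bound by the square of
  \<open>card \<Lambda>\<close> also counts ordered pairs of lines.\<close>

definition crossings :: "((real \<times> real) \<times> (real \<times> real)) set" where
  "crossings = {(e, f). e \<in> edges \<and> f \<in> edges \<and> e \<noteq> f \<and>
     (\<exists>x. fst e < x \<and> fst f < x \<and> x < snd e \<and> x < snd f \<and>
       slope e * x + icpt e = slope f * x + icpt f)}"

lemma line_at_fst: "slope e * fst e + icpt e = h (fst e)"
  by (simp add: icpt_def)

lemma line_at_snd:
  assumes "fst e < snd e"
  shows "slope e * snd e + icpt e = h (snd e)"
proof -
  have "slope e * (snd e - fst e) = h (snd e) - h (fst e)"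
    using assms by (simp add: slope_def)
  then show ?thesis by (simp add: icpt_def algebra_simps)
qed

lemma line_unique:
  fixes a b a' b' x x' :: real
  assumes "a * x + b = a' * x + b'" "a * x' + b = a' * x' + b'" "x \<noteq> x'"
  shows "a = a' \<and> b = b'"
proof -
  have "(a - a') * (x - x') = 0" using assms(1,2) by (simp add: algebra_simps)
  then show ?thesis using assms by simp
qed

lemma line_eqI:
  assumes "l \<in> on_line L" "r \<in> on_line L" "l < r"
  shows "line (l, r) = L"
proof -
  have "slope (l, r) * l + icpt (l, r) = fst L * l + snd L"
    using line_at_fst[of "(l, r)"] assms(1) by (simp add: on_line_def)
  moreover have "slope (l, r) * r + icpt (l, r) = fst L * r + snd L"
    using line_at_snd[of "(l, r)"] assms(2,3) by (simp add: on_line_def)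
  ultimately show ?thesis
    using line_unique[of "slope (l, r)" l "icpt (l, r)" "fst L" "snd L" r] assms(3)
    by (simp add: line_def prod_eq_iff)
qed

lemma finite_edges: "finite edges"
  by (rule finite_subset[of _ "X \<times> X"]) (auto simp: edges_def finX)

lemma finite_crossings: "finite crossings"
  by (rule finite_subset[of _ "edges \<times> edges"]) (auto simp: crossings_def finite_edges)

lemma edgesD:
  assumes "e \<in> edges"
  shows "fst e \<in> X" "snd e \<in> X" "fst e < snd e" "line e \<in> \<Lambda>"
    "\<And>z. z \<in> X \<Longrightarrow> fst e < z \<Longrightarrow> z < snd e \<Longrightarrow> h z \<noteq> slope e * z + icpt e"
  using assms by (auto simp: edges_def)

text \<open>Every point of the line but the last starts an edge to its successor on the
  line.\<close>

lemma card_fibre: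
  assumes "L \<in> \<Lambda>"
  shows "card (on_line L) - 1 \<le> card {e\<in>edges. line e = L}"
proof -
  define succ where "succ l = Min {z\<in>on_line L. l < z}" for l
  define B where "B = on_line L - {Max (on_line L)}"
  have fin: "finite (on_line L)" using finX by (simp add: on_line_def)
  have succ: "succ l \<in> on_line L" "l < succ l" "\<And>z. z \<in> on_line L \<Longrightarrow> l < z \<Longrightarrow> succ l \<le> z"
    if "l \<in> B" for l
  proof -
    have "l < Max (on_line L)" "on_line L \<noteq> {}"
      using that fin by (auto simp: B_def order.strict_iff_order)
    then have "{z\<in>on_line L. l < z} \<noteq> {}" using Max_in[OF fin] by blast
    then have "succ l \<in> {z\<in>on_line L. l < z}"
      unfolding succ_def using fin by (intro Min_in) auto
    then show "succ l \<in> on_line L" "l < succ l" by auto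
    show "succ l \<le> z" if "z \<in> on_line L" "l < z" for z
      unfolding succ_def using fin that by (intro Min_le) auto
  qed
  have "card B \<le> card {e\<in>edges. line e = L}"
  proof (rule card_inj_on_le)
    show "inj_on (\<lambda>l. (l, succ l)) B" by (auto intro: inj_onI)
    show "finite {e\<in>edges. line e = L}" using finite_edges by simp
    show "(\<lambda>l. (l, succ l)) ` B \<subseteq> {e\<in>edges. line e = L}"
    proof
      fix e assume "e \<in> (\<lambda>l. (l, succ l)) ` B"
      then obtain l where l: "l \<in> B" "e = (l, succ l)" by auto
      have ln: "line e = L" using line_eqI[of l L "succ l"] succ[OF l(1)] l by (simp add: B_def)
      then have sl: "slope e = fst L" "icpt e = snd L" by (auto simp: line_def)
      have "h z \<noteq> slope e * z + icpt e" if "z \<in> X" "l < z" "z < succ l" for z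
        using succ(3)[OF l(1), of z] that by (auto simp: sl on_line_def)
      then have "e \<in> edges"
        using ln assms succ[OF l(1)] l by (auto simp: edges_def B_def on_line_def)
      with ln show "e \<in> {e\<in>edges. line e = L}" by simp
    qed
  qed
  moreover have "card (on_line L) - 1 \<le> card B"
    using fin by (cases "on_line L = {}") (auto simp: B_def card_Diff_singleton_if)
  ultimately show ?thesis by simp
qed

lemma edges_lower:
  assumes "\<And>L. L \<in> \<Lambda> \<Longrightarrow> t \<le> real (card (on_line L))" "2 \<le> t"
  shows "real (card \<Lambda>) * t / 2 \<le> real (card edges)"
proof -
  have "edges = (\<Union>L\<in>\<Lambda>. {e\<in>edges. line e = L})" using edgesD(4) by auto
  then have "card edges = card \<dots>" by (rule arg_cong)
  also have "\<dots> = (\<Sum>L\<in>\<Lambda>. card {e\<in>edges. line e = L})"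
    using card_UN_disjoint[OF fin\<Lambda>, of "\<lambda>L. {e\<in>edges. line e = L}"] finite_edges by auto
  finally have "card edges = (\<Sum>L\<in>\<Lambda>. card {e\<in>edges. line e = L})" .
  \<comment> \<open>Here \<open>t - 1\<close> is at least \<open>t / 2\<close>, since
    \<open>t\<close> is at least 2.\<close>
  moreover have "t / 2 \<le> real (card {e\<in>edges. line e = L})" if "L \<in> \<Lambda>" for L
    using card_fibre[OF that] assms(1)[OF that] assms(2) by linarith
  then have "(\<Sum>L\<in>\<Lambda>. t / 2) \<le> (\<Sum>L\<in>\<Lambda>. real (card {e\<in>edges. line e = L}))"
    by (rule sum_mono)
  ultimately show ?thesis by simp
qed

text \<open>Edges contain no point of \<open>X\<close> in their interior. If the edges differed, an
  end of one would lie strictly inside the other.\<close>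

lemma same_line_overlap:
  assumes e: "e \<in> edges" and f: "f \<in> edges" and "line e = line f"
    and "fst e < x" "fst f < x" "x < snd e" "x < snd f"
  shows "e = f"
proof -
  have eq: "slope e = slope f" "icpt e = icpt f" using assms(3) by (auto simp: line_def)
  have "\<not> fst e < fst f"
    using edgesD(5)[OF e edgesD(1)[OF f]] line_at_fst[of f] eq assms(4-7) by force
  moreover have "\<not> fst f < fst e"
    using edgesD(5)[OF f edgesD(1)[OF e]] line_at_fst[of e] eq assms(4-7) by force
  moreover have "\<not> snd e < snd f"
    using edgesD(5)[OF f edgesD(2)[OF e]] line_at_snd[OF edgesD(3)[OF e]] eq assms(4-7) by force
  moreover have "\<not> snd f < snd e"
    using edgesD(5)[OF e edgesD(2)[OF f]] line_at_snd[OF edgesD(3)[OF f]] eq assms(4-7) by force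
  ultimately show ?thesis by (simp add: prod_eq_iff)
qed

lemma crossing_lines_neq:
  assumes "(e, f) \<in> crossings"
  shows "line e \<noteq> line f"
  using assms same_line_overlap unfolding crossings_def by blast

text \<open>Two different lines meet in one point, so the pair of lines determines the abscissa of
  the crossing, and on each line at most one edge passes over that abscissa.\<close>

lemma card_crossings_le: "card crossings \<le> card \<Lambda> ^ 2"
proof -
  have "card crossings \<le> card (\<Lambda> \<times> \<Lambda>)"
  proof (rule card_inj_on_le)
    show "(\<lambda>(e, f). (line e, line f)) ` crossings \<subseteq> \<Lambda> \<times> \<Lambda>"
      using edgesD(4) by (auto simp: crossings_def)
    show "inj_on (\<lambda>(e, f). (line e, line f)) crossings"
    proof (rule inj_onI, clarify)
      fix e f e' f' :: "real \<times> real"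
      assume *: "(e, f) \<in> crossings" "(e', f') \<in> crossings" "line e = line e'" "line f = line f'"
      obtain x where x: "fst e < x" "fst f < x" "x < snd e" "x < snd f"
        "slope e * x + icpt e = slope f * x + icpt f"
        using *(1) by (auto simp: crossings_def)
      obtain x' where x': "fst e' < x'" "fst f' < x'" "x' < snd e'" "x' < snd f'"
        "slope e' * x' + icpt e' = slope f' * x' + icpt f'"
        using *(2) by (auto simp: crossings_def)
      have "slope e * x' + icpt e = slope f * x' + icpt f" using x'(5) *(3,4) by (auto simp: line_def)
      then have "x = x'"
        using line_unique[OF x(5), of x'] crossing_lines_neq[OF *(1)] unfolding line_def by blast
      moreover have "e \<in> edges" "f \<in> edges" "e' \<in> edges" "f' \<in> edges"
        using *(1,2) by (auto simp: crossings_def)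
      ultimately show "e = e' \<and> f = f'"
        using same_line_overlap[of e e' x] same_line_overlap[of f f' x] *(3,4) x(1-4) x'(1-4)
        by simp
    qed
  qed (simp add: fin\<Lambda>)
  then show ?thesis by (simp add: card_cartesian_product power2_eq_square)
qed

definition ends :: "(real \<times> real) \<times> (real \<times> real) \<Rightarrow> real set" where
  "ends c = {fst (fst c), snd (fst c), fst (snd c), snd (snd c)}"

text \<open>A common end would be a second common point of two different lines, besides the
  crossing. That the four ends are distinct is what gives a crossing the survival probability
  \<open>p ^ 4\<close>.\<close>

lemma card_ends:
  assumes "c \<in> crossings"
  shows "card (ends c) = 4"
proof -
  obtain e f where c: "c = (e, f)" by (cases c)
  obtain x where x: "fst e < x" "fst f < x" "x < snd e" "x < snd f"
    "slope e * x + icpt e = slope f * x + icpt f" "e \<in> edges" "f \<in> edges"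
    using assms by (auto simp: crossings_def c)
  have neq: "z \<noteq> w" if "slope e * z + icpt e = h z" "slope f * w + icpt f = h w" "z \<noteq> x" for z w
    using line_unique[OF x(5), of z] that crossing_lines_neq[OF assms[unfolded c]]
    unfolding line_def by metis
  have lt: "fst e < snd e" "fst f < snd f" using edgesD(3) x(6,7) by auto
  have "fst e \<noteq> fst f" "fst e \<noteq> snd f" "snd e \<noteq> fst f" "snd e \<noteq> snd f"
    using neq[OF line_at_fst line_at_fst] neq[OF line_at_fst line_at_snd[OF lt(2)]]
      neq[OF line_at_snd[OF lt(1)] line_at_fst] neq[OF line_at_snd[OF lt(1)] line_at_snd[OF lt(2)]]
      x(1,3) by auto
  then show ?thesis using lt by (simp add: ends_def c)
qed

text \<open>Deleting one edge from each crossing leaves a plane graph.\<close>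

lemma edges_in_subset:
  assumes "S \<subseteq> X"
  shows "card {e\<in>edges. {fst e, snd e} \<subseteq> S} \<le> 3 * card S + card {c\<in>crossings. ends c \<subseteq> S}"
proof -
  define ES where "ES = {e\<in>edges. {fst e, snd e} \<subseteq> S}"
  define CS where "CS = {c\<in>crossings. ends c \<subseteq> S}"
  define G where "G = ES - fst ` CS"
  have cs: "(e, f) \<in> CS" if "e \<in> ES" "f \<in> ES" "e \<noteq> f" "fst e < x" "fst f < x" "x < snd e" "x < snd f"
    "slope e * x + icpt e = slope f * x + icpt f" for e f x
    using that by (auto simp: CS_def ES_def crossings_def ends_def)
  interpret plane_graph S h G slope icpt
  proof
    show "finite S" using assms finX finite_subset by blast
  next
    fix l r w assume *: "(l, r) \<in> G" "w \<in> S" "l < w" "w < r"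
    then show "slope (l, r) * w + icpt (l, r) \<noteq> h w"
      using edgesD(5)[of "(l, r)" w] assms by (auto simp: G_def ES_def)
  next
    fix l r l' r' x
    assume *: "(l, r) \<in> G" "(l', r') \<in> G" "(l, r) \<noteq> (l', r')" "l < x" "l' < x" "x < r" "x < r'"
    show "slope (l, r) * x + icpt (l, r) \<noteq> slope (l', r') * x + icpt (l', r')"
    proof
      assume "slope (l, r) * x + icpt (l, r) = slope (l', r') * x + icpt (l', r')"
      then have "((l, r), (l', r')) \<in> CS" by (intro cs[where x = x]) (use * in \<open>auto simp: G_def\<close>)
      then show False using *(1) by (force simp: G_def)
    qed
  next
    fix l r assume *: "(l, r) \<in> G"
    then have "(l, r) \<in> edges" by (simp add: G_def ES_def)
    with * show "l \<in> S \<and> r \<in> S \<and> l < r" "slope (l, r) * l + icpt (l, r) = h l"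
      "slope (l, r) * r + icpt (l, r) = h r"
      using edgesD(3)[of "(l, r)"] line_at_fst[of "(l, r)"] line_at_snd[of "(l, r)"]
      by (auto simp: G_def ES_def)
  qed
  have "finite CS" using finite_crossings by (simp add: CS_def)
  have "card ES \<le> card (G \<union> fst ` CS)"
    by (rule card_mono) (use \<open>finite CS\<close> finite_edges in \<open>auto simp: G_def ES_def\<close>)
  also have "\<dots> \<le> card G + card CS"
    using card_Un_le[of G "fst ` CS"] card_image_le[OF \<open>finite CS\<close>, of fst] by linarith
  finally show ?thesis using card_edges by (simp add: ES_def CS_def)
qed

text \<open>The expectation of \<open>edges_in_subset\<close> over a random
  \<open>S\<close>.\<close>

lemma crossing_inequality:
  assumes "0 \<le> p" "p \<le> 1"
  shows "real (card edges) * p\<^sup>2 \<le> 3 * (real (card X) * p) + real (card crossings) * p ^ 4"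
proof -
  have "real (card edges) * p\<^sup>2 = expect X p (\<lambda>S. real (card {e\<in>edges. {fst e, snd e} \<subseteq> S}))"
  proof (rule expect_card_superset[OF finX finite_edges, symmetric])
    fix e assume "e \<in> edges"
    then show "{fst e, snd e} \<subseteq> X \<and> card {fst e, snd e} = 2"
      using edgesD(1-3)[of e] by (simp add: less_imp_neq)
  qed
  also have "\<dots> \<le> expect X p (\<lambda>S. 3 * real (card S) + real (card {c\<in>crossings. ends c \<subseteq> S}))"
  proof (rule expect_mono[OF assms])
    fix S assume "S \<subseteq> X"
    from edges_in_subset[OF this] show "real (card {e\<in>edges. {fst e, snd e} \<subseteq> S})
      \<le> 3 * real (card S) + real (card {c\<in>crossings. ends c \<subseteq> S})" by linarith
  qed
  also have "\<dots> = 3 * (real (card X) * p) + real (card crossings) * p ^ 4"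
  proof -
    have "expect X p (\<lambda>S. real (card {c\<in>crossings. ends c \<subseteq> S})) = real (card crossings) * p ^ 4"
    proof (rule expect_card_superset[OF finX finite_crossings])
      fix c assume "c \<in> crossings"
      then show "ends c \<subseteq> X \<and> card (ends c) = 4"
        using card_ends[of c] edgesD(1,2)[of "fst c"] edgesD(1,2)[of "snd c"]
        by (auto simp: crossings_def ends_def)
    qed
    then show ?thesis by (simp add: expect_add expect_mult expect_card[OF finX])
  qed
  finally show ?thesis .
qed

lemma crossing_bound:
  assumes "6 * card X \<le> card edges"
  shows "real (card edges) ^ 3 \<le> 72 * real (card X) ^ 2 * real (card \<Lambda>) ^ 2"
proof (cases "card X = 0")
  case True
  then have "X = {}" using finX by simp
  then have "edges = {}" unfolding edges_def by simp
  then show ?thesis by simp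
next
  case False
  define n E c where "n = real (card X)" and "E = real (card edges)" and "c = real (card crossings)"
  have n: "n > 0" "6 * n \<le> E" using False assms by (auto simp: n_def E_def)
  \<comment> \<open>Makes the linear term \<open>3 * n * p\<close> half of
    \<open>E * p\<^sup>2\<close>; the assumed lower bound on the number of edges says that
    \<open>p\<close> is at most 1.\<close>
  define p where "p = 6 * n / E"
  have "E > 0" using n by linarith
  have p: "0 \<le> p" "p \<le> 1" using n \<open>E > 0\<close> by (auto simp: p_def)
  have Ep: "E * p = 6 * n" using \<open>E > 0\<close> by (simp add: p_def)
  have "E * p\<^sup>2 \<le> 3 * (n * p) + c * p ^ 4"
    using crossing_inequality[OF p] by (simp add: n_def E_def c_def)
  also have "E * p\<^sup>2 = 6 * n * p" using Ep by (simp add: power2_eq_square)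
  finally have "3 * n * p \<le> c * p ^ 4" by simp
  then have "3 * n * p * E ^ 4 \<le> c * p ^ 4 * E ^ 4" using \<open>E > 0\<close> by (intro mult_right_mono) auto
  also have "c * p ^ 4 * E ^ 4 = c * (E * p) ^ 4" by (simp add: power_mult_distrib)
  also have "\<dots> = c * (6 * n) ^ 4" by (simp add: Ep)
  also have "3 * n * p * E ^ 4 = 3 * n * E ^ 3 * (E * p)" by (simp add: power_numeral_reduce)
  also have "\<dots> = 18 * n\<^sup>2 * E ^ 3" by (simp add: Ep power_numeral_reduce)
  finally have "(18 * n\<^sup>2) * E ^ 3 \<le> (18 * n\<^sup>2) * (72 * n\<^sup>2 * c)" by (simp add: power_numeral_reduce)
  then have "E ^ 3 \<le> 72 * n\<^sup>2 * c" using n by (subst (asm) mult_le_cancel_left_pos) simp_all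
  also have "\<dots> \<le> 72 * n\<^sup>2 * (real (card \<Lambda>))\<^sup>2"
    using card_crossings_le by (intro mult_left_mono) (simp_all add: c_def flip: of_nat_power)
  finally show ?thesis by (simp add: E_def n_def)
qed

text \<open>With fewer than \<open>6 * card X\<close> edges the second term suffices. Otherwise at
  least \<open>N * t / 2\<close> edges enter \<open>crossing_bound\<close>, and 576 = 8 * 72 gives
  the first term.\<close>

theorem szemeredi_trotter:
  assumes rich: "\<And>L. L \<in> \<Lambda> \<Longrightarrow> t \<le> real (card (on_line L))" and t: "2 \<le> t"
  shows "real (card \<Lambda>) \<le> 576 * (real (card X) ^ 2 / t ^ 3 + real (card X) / t)"
proof -
  define n N where "n = real (card X)" and "N = real (card \<Lambda>)"
  have n: "n \<ge> 0" by (simp add: n_def)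
  have low: "N * t / 2 \<le> real (card edges)" using edges_lower[OF rich t] by (simp add: N_def)
  show ?thesis
  proof (cases "6 * card X \<le> card edges")
    case False
    then have "N * t / 2 \<le> 6 * n" using low by (simp add: n_def)
    then have "N \<le> 12 * (n / t)" using t by (simp add: field_simps)
    moreover have "0 \<le> n\<^sup>2 / t ^ 3" "0 \<le> n / t" using t n by auto
    ultimately show ?thesis unfolding n_def[symmetric] N_def[symmetric] distrib_left by linarith
  next
    case True
    have "N \<le> 576 * (n\<^sup>2 / t ^ 3)"
    proof (cases "N = 0")
      case True
      then show ?thesis using t by simp
    next
      case False
      then have "N > 0" by (simp add: N_def)
      have "(N * t / 2) ^ 3 \<le> real (card edges) ^ 3"
        using low t \<open>N > 0\<close> by (intro power_mono) auto
      also have "\<dots> \<le> 72 * n\<^sup>2 * N\<^sup>2" using crossing_bound[OF True] by (simp add: n_def N_def)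
      finally have "N\<^sup>2 * (N * t ^ 3) \<le> N\<^sup>2 * (576 * n\<^sup>2)"
        by (simp add: power_numeral_reduce field_simps)
      then have "N * t ^ 3 \<le> 576 * n\<^sup>2" using \<open>N > 0\<close> by simp
      then show ?thesis using t by (simp add: field_simps)
    qed
    moreover have "0 \<le> n / t" using t n by auto
    ultimately show ?thesis unfolding n_def[symmetric] N_def[symmetric] distrib_left by linarith
  qed
qed

end

section \<open>Projection to the plane\<close>

text \<open>The points of \<open>Z\<close> are treated one at a time. Adding a multiple of the
  component \<open>b\<close> of \<open>z\<close> orthogonal to \<open>Q\<close> keeps the functional
  zero on \<open>Q\<close>, and only finitely many multiples make it vanish at \<open>z\<close> or
  at an earlier point.\<close>

lemma exists_functional:
  fixes Q Z :: "'a::euclidean_space set"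
  assumes Q: "subspace Q" and "finite Z" "Z \<inter> Q = {}"
  shows "\<exists>w. (\<forall>q\<in>Q. w \<bullet> q = 0) \<and> (\<forall>z\<in>Z. w \<bullet> z \<noteq> 0)"
  using assms(2,3)
proof (induction Z rule: finite_induct)
  case empty
  show ?case by (rule exI[of _ 0]) simp
next
  case (insert z Z)
  then obtain w where w: "\<And>q. q \<in> Q \<Longrightarrow> w \<bullet> q = 0" "\<And>x. x \<in> Z \<Longrightarrow> w \<bullet> x \<noteq> 0"
    by auto
  obtain a b where ab: "a \<in> span Q" "\<And>x. x \<in> span Q \<Longrightarrow> orthogonal b x" "z = a + b"
    using orthogonal_subspace_decomp_exists[of Q z] by metis
  have spQ: "span Q = Q" using Q by (simp add: span_eq_iff)
  have "b \<noteq> 0" using ab insert.prems spQ by auto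
  have bz: "b \<bullet> z \<noteq> 0"
    using ab(2)[OF ab(1)] \<open>b \<noteq> 0\<close> by (simp add: ab(3) inner_add_right orthogonal_def)
  obtain \<epsilon> :: real where \<epsilon>: "\<epsilon> \<notin> (\<lambda>x. - (w \<bullet> x) / (b \<bullet> x)) ` (insert z Z)" "\<epsilon> \<noteq> 0"
  proof -
    have "finite (insert 0 ((\<lambda>x. - (w \<bullet> x) / (b \<bullet> x)) ` (insert z Z)))"
      using insert.hyps by simp
    from ex_new_if_finite[OF infinite_UNIV_char_0 this] show thesis by (auto intro: that)
  qed
  have "(w + \<epsilon> *\<^sub>R b) \<bullet> x \<noteq> 0" if "x \<in> insert z Z" for x
  proof (cases "b \<bullet> x = 0")
    case True
    then have "x \<in> Z" using that bz by auto
    then show ?thesis using w True by (simp add: inner_add_left)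
  next
    case False
    have "\<epsilon> \<noteq> - (w \<bullet> x) / (b \<bullet> x)" using \<epsilon>(1) that by blast
    then show ?thesis using False by (auto simp: inner_add_left field_simps)
  qed
  moreover have "(w + \<epsilon> *\<^sub>R b) \<bullet> q = 0" if "q \<in> Q" for q
    using w(1)[OF that] ab(2)[of q] that spQ by (simp add: inner_add_left orthogonal_def)
  ultimately show ?case by blast
qed

lemma span_insert_combination:
  fixes Q :: "'a::real_vector set"
  assumes "p *\<^sub>R x + q \<in> span Q" "p \<noteq> 0"
  shows "x \<in> span (insert q Q)"
proof -
  have "p *\<^sub>R x + q \<in> span (insert q Q)" using assms(1) span_mono[of Q "insert q Q"] by auto
  moreover have "q \<in> span (insert q Q)" by (simp add: span_base)
  ultimately have "p *\<^sub>R x + q - q \<in> span (insert q Q)" by (rule span_diff)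
  then have "p *\<^sub>R x \<in> span (insert q Q)" by simp
  then have "inverse p *\<^sub>R (p *\<^sub>R x) \<in> span (insert q Q)" by (rule span_scale)
  with assms(2) show ?thesis by simp
qed

text \<open>Projecting the space centrally from \<open>Q\<close> to a generic plane turns the subspaces \<open>H\<close> into
  lines. The functionals are chosen one after the other: \<open>\<phi>\<close> defines the chart of the projective
  plane, \<open>\<xi>\<close> separates abscissae, and \<open>\<eta>\<close> keeps non-collinear triples non-collinear.\<close>

theorem szemeredi_trotter_projective:
  fixes Q A :: "'a::euclidean_space set" and \<H> :: "'a set set"
  assumes Q: "subspace Q" and A: "finite A" "A \<inter> Q = {}"
    and indep: "\<And>a b. a \<in> A \<Longrightarrow> b \<in> A \<Longrightarrow> a \<noteq> b \<Longrightarrow> b \<notin> span (insert a Q)"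
    and \<H>: "finite \<H>" "\<And>H. H \<in> \<H> \<Longrightarrow> subspace H \<and> Q \<subseteq> H \<and> dim H = dim Q + 2"
    and rich: "\<And>H. H \<in> \<H> \<Longrightarrow> t \<le> real (card (A \<inter> H))" and t: "2 \<le> t"
  shows "real (card \<H>) \<le> 576 * (real (card A) ^ 2 / t ^ 3 + real (card A) / t)"
proof -
  have spQ: "span Q = Q" using Q by (simp add: span_eq_iff)
  obtain \<phi> where \<phi>Q: "\<And>q. q \<in> Q \<Longrightarrow> \<phi> \<bullet> q = 0" and \<phi>: "\<And>a. a \<in> A \<Longrightarrow> \<phi> \<bullet> a \<noteq> 0"
    using exists_functional[OF Q A] by blast
  \<comment> \<open>The combination of \<open>a\<close> and \<open>b\<close> on which \<phi>
    vanishes; \<xi> vanishes on it exactly when \<open>a\<close> and \<open>b\<close> get the same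
    abscissa.\<close>
  define v2 where "v2 a b = (\<phi> \<bullet> b) *\<^sub>R a - (\<phi> \<bullet> a) *\<^sub>R b" for a b
  have v2Q: "v2 a b \<notin> Q" if "a \<in> A" "b \<in> A" "a \<noteq> b" for a b
  proof
    assume "v2 a b \<in> Q"
    then have "(- (\<phi> \<bullet> a)) *\<^sub>R b + (\<phi> \<bullet> b) *\<^sub>R a \<in> span Q" by (simp add: v2_def spQ)
    then have "b \<in> span (insert ((\<phi> \<bullet> b) *\<^sub>R a) Q)"
      by (rule span_insert_combination) (use \<phi> that in auto)
    also have "\<dots> \<subseteq> span (insert a Q)"
      by (rule span_minimal) (auto intro: span_base span_scale)
    finally show False using indep that by blast
  qed
  obtain \<xi> where \<xi>Q: "\<And>q. q \<in> Q \<Longrightarrow> \<xi> \<bullet> q = 0"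
    and \<xi>: "\<And>a b. a \<in> A \<Longrightarrow> b \<in> A \<Longrightarrow> a \<noteq> b \<Longrightarrow> \<xi> \<bullet> v2 a b \<noteq> 0"
  proof -
    let ?Z = "(\<lambda>(a, b). v2 a b) ` {(a, b) \<in> A \<times> A. a \<noteq> b}"
    have fin: "finite ?Z" using A(1) by (intro finite_imageI) (auto intro: finite_subset[of _ "A \<times> A"])
    have disj: "?Z \<inter> Q = {}" using v2Q by auto
    obtain w where "\<forall>q\<in>Q. w \<bullet> q = 0" "\<forall>z\<in>?Z. w \<bullet> z \<noteq> 0"
      using exists_functional[OF Q fin disj] by (elim exE conjE)
    then show thesis by (intro that[of w]) auto
  qed
  define m where "m a b = \<xi> \<bullet> v2 a b" for a b
  have m_eq: "m a b = (\<xi> \<bullet> a) * (\<phi> \<bullet> b) - (\<xi> \<bullet> b) * (\<phi> \<bullet> a)" for a b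
    by (simp add: m_def v2_def inner_diff_right)
  \<comment> \<open>\<open>\<eta> \<bullet> v3 a b c\<close> is the determinant of the homogeneous
    coordinates (\<xi>, \<phi>, \<eta>) of the three points, so it is zero exactly when their images
    are collinear.\<close>
  define v3 where "v3 a b c = m a b *\<^sub>R c + (m b c *\<^sub>R a + m c a *\<^sub>R b)" for a b c
  have v3Q: "v3 a b c \<notin> Q" if "a \<in> A" "b \<in> A" "a \<noteq> b" "c \<notin> span (insert a (insert b Q))" for a b c
  proof
    assume "v3 a b c \<in> Q"
    then have "m a b *\<^sub>R c + (m b c *\<^sub>R a + m c a *\<^sub>R b) \<in> span Q" by (simp add: v3_def spQ)
    then have "c \<in> span (insert (m b c *\<^sub>R a + m c a *\<^sub>R b) Q)"
      by (rule span_insert_combination) (use \<xi> that in \<open>auto simp: m_def\<close>)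
    also have "\<dots> \<subseteq> span (insert a (insert b Q))"
      by (rule span_minimal) (auto intro: span_base span_scale span_add)
    finally show False using that by blast
  qed
  obtain \<eta> where \<eta>Q: "\<And>q. q \<in> Q \<Longrightarrow> \<eta> \<bullet> q = 0"
    and \<eta>: "\<And>a b c. a \<in> A \<Longrightarrow> b \<in> A \<Longrightarrow> c \<in> A \<Longrightarrow> a \<noteq> b \<Longrightarrow> c \<notin> span (insert a (insert b Q)) \<Longrightarrow>
      \<eta> \<bullet> v3 a b c \<noteq> 0"
  proof -
    let ?Z = "(\<lambda>(a, b, c). v3 a b c) `
      {(a, b, c) \<in> A \<times> A \<times> A. a \<noteq> b \<and> c \<notin> span (insert a (insert b Q))}"
    have fin: "finite ?Z"
      using A(1) by (intro finite_imageI) (auto intro: finite_subset[of _ "A \<times> A \<times> A"])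
    have disj: "?Z \<inter> Q = {}" using v3Q by auto
    obtain w where "\<forall>q\<in>Q. w \<bullet> q = 0" "\<forall>z\<in>?Z. w \<bullet> z \<noteq> 0"
      using exists_functional[OF Q fin disj] by (elim exE conjE)
    then show thesis by (intro that[of w]) auto
  qed
  define x where "x a = (\<xi> \<bullet> a) / (\<phi> \<bullet> a)" for a
  have x_inj: "inj_on x A"
  proof (rule inj_onI, rule ccontr)
    fix a b assume *: "a \<in> A" "b \<in> A" "x a = x b" "a \<noteq> b"
    then have "m a b = 0" using \<phi>[OF *(1)] \<phi>[OF *(2)] by (auto simp: x_def m_eq field_simps)
    then show False using \<xi>[OF *(1,2,4)] by (simp add: m_def)
  qed
  \<comment> \<open>The image of \<open>a\<close> has abscissa \<open>x a\<close> and ordinate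
    \<open>(\<eta> \<bullet> a) / (\<phi> \<bullet> a)\<close>. Since \<open>point_lines\<close>
    wants the ordinate as a function of the abscissa, \<open>a\<close> is recovered from
    \<open>x a\<close>.\<close>
  define h where "h z = (let a = the_inv_into A x z in (\<eta> \<bullet> a) / (\<phi> \<bullet> a))" for z
  have h_x: "h (x a) = (\<eta> \<bullet> a) / (\<phi> \<bullet> a)" if "a \<in> A" for a
    using the_inv_into_f_f[OF x_inj that] by (simp add: h_def)
  have h_line: "h (x a) = fst L * x a + snd L \<longleftrightarrow> \<eta> \<bullet> a = fst L * (\<xi> \<bullet> a) + snd L * (\<phi> \<bullet> a)"
    if "a \<in> A" for a L
    unfolding h_x[OF that] using \<phi>[OF that] by (simp add: x_def field_simps)
  have two: "\<exists>a\<in>A \<inter> H. \<exists>b\<in>A \<inter> H. a \<noteq> b" if "H \<in> \<H>" for H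
  proof -
    have "2 \<le> card (A \<inter> H)" using rich[OF that] t by linarith
    then have "\<not> card (A \<inter> H) \<le> Suc 0" by simp
    then show ?thesis using card_le_Suc0_iff_eq[of "A \<inter> H"] A(1) by blast
  qed
  have dim2: "dim (insert a (insert b Q)) = dim Q + 2" if "a \<in> A" "b \<in> A" "a \<noteq> b" for a b
  proof -
    have "b \<notin> span Q" using that A(2) unfolding spQ by blast
    moreover have "a \<notin> span (insert b Q)" using indep[of b a] that by simp
    ultimately show ?thesis by (simp add: dim_insert)
  qed
  have H_eq: "H = span (insert a (insert b Q))"
    if "H \<in> \<H>" "a \<in> A \<inter> H" "b \<in> A \<inter> H" "a \<noteq> b" for H a b
  proof -
    have "span (insert a (insert b Q)) \<subseteq> H"
      using \<H>(2)[OF that(1)] that by (intro span_minimal) auto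
    moreover have "dim H \<le> dim (span (insert a (insert b Q)))"
      using \<H>(2)[OF that(1)] dim2[of a b] that by (simp add: dim_span)
    ultimately have "span (insert a (insert b Q)) = H"
      using \<H>(2)[OF that(1)] by (intro subspace_dim_equal subspace_span) blast+
    then show ?thesis ..
  qed
  have "\<exists>L. \<forall>a\<in>A \<inter> H. \<eta> \<bullet> a = fst L * (\<xi> \<bullet> a) + snd L * (\<phi> \<bullet> a)" if H: "H \<in> \<H>" for H
  proof -
    obtain a b where ab: "a \<in> A \<inter> H" "b \<in> A \<inter> H" "a \<noteq> b" using two[OF H] by blast
    have m: "m a b \<noteq> 0" using \<xi> ab by (auto simp: m_def)
    \<comment> \<open>The line through the images of \<open>a\<close> and \<open>b\<close>, by
      Cramer's rule. The functional \<open>w\<close> below then vanishes at \<open>a\<close>, at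
      \<open>b\<close> and on \<open>Q\<close>, hence on all of \<open>H\<close>.\<close>
    define L where "L = (((\<eta> \<bullet> a) * (\<phi> \<bullet> b) - (\<eta> \<bullet> b) * (\<phi> \<bullet> a)) / m a b,
      ((\<xi> \<bullet> a) * (\<eta> \<bullet> b) - (\<xi> \<bullet> b) * (\<eta> \<bullet> a)) / m a b)"
    define w where "w = \<eta> - (fst L *\<^sub>R \<xi> + snd L *\<^sub>R \<phi>)"
    have mL: "m a b * fst L = (\<eta> \<bullet> a) * (\<phi> \<bullet> b) - (\<eta> \<bullet> b) * (\<phi> \<bullet> a)"
      "m a b * snd L = (\<xi> \<bullet> a) * (\<eta> \<bullet> b) - (\<xi> \<bullet> b) * (\<eta> \<bullet> a)"
      using m by (simp_all add: L_def)
    have mw: "m a b * (w \<bullet> z) = m a b * (\<eta> \<bullet> z) - (m a b * fst L) * (\<xi> \<bullet> z) - (m a b * snd L) * (\<phi> \<bullet> z)" for z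
      by (simp add: w_def inner_diff_left inner_add_left algebra_simps)
    have "m a b * (w \<bullet> a) = 0" "m a b * (w \<bullet> b) = 0"
      unfolding mw mL by (simp_all add: m_eq algebra_simps)
    then have w: "w \<bullet> a = 0" "w \<bullet> b = 0" using m by auto
    have "w \<bullet> q = 0" if "q \<in> insert a (insert b Q)" for q
      using that w \<eta>Q \<xi>Q \<phi>Q by (auto simp: w_def inner_diff_left inner_add_left)
    then have "insert a (insert b Q) \<subseteq> {z. w \<bullet> z = 0}" by auto
    then have "H \<subseteq> {z. w \<bullet> z = 0}"
      unfolding H_eq[OF H ab] by (rule span_minimal) (rule subspace_hyperplane)
    then have "\<forall>z\<in>A \<inter> H. w \<bullet> z = 0" by blast
    then show ?thesis by (intro exI[of _ L]) (simp add: w_def inner_diff_left inner_add_left)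
  qed
  then obtain \<L> where \<L>: "\<And>H a. H \<in> \<H> \<Longrightarrow> a \<in> A \<inter> H \<Longrightarrow>
      \<eta> \<bullet> a = fst (\<L> H) * (\<xi> \<bullet> a) + snd (\<L> H) * (\<phi> \<bullet> a)"
    by metis
  have \<L>_inj: "inj_on \<L> \<H>"
  proof (rule inj_onI, rule ccontr)
    fix H H' assume HH: "H \<in> \<H>" "H' \<in> \<H>" "\<L> H = \<L> H'" "H \<noteq> H'"
    obtain a b where ab: "a \<in> A \<inter> H" "b \<in> A \<inter> H" "a \<noteq> b" using two[OF HH(1)] by blast
    obtain a' b' where ab': "a' \<in> A \<inter> H'" "b' \<in> A \<inter> H'" "a' \<noteq> b'" using two[OF HH(2)] by blast
    \<comment> \<open>A point \<open>c\<close> of \<open>H'\<close> outside \<open>H\<close> whose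
      image lies on the line of \<open>a\<close> and \<open>b\<close> would contradict the choice of
      \<eta>.\<close>
    have "\<not> (a' \<in> H \<and> b' \<in> H)"
      using H_eq[OF HH(1), of a' b'] H_eq[OF HH(2), of a' b'] ab' HH(4) by blast
    then obtain c where c: "c \<in> A \<inter> H'" "c \<notin> H" using ab' by blast
    define p q where "p = fst (\<L> H)" and "q = snd (\<L> H)"
    have la: "\<eta> \<bullet> a = p * (\<xi> \<bullet> a) + q * (\<phi> \<bullet> a)"
      and lb: "\<eta> \<bullet> b = p * (\<xi> \<bullet> b) + q * (\<phi> \<bullet> b)"
      unfolding p_def q_def by (rule \<L>[OF HH(1)], fact ab)+
    have lc: "\<eta> \<bullet> c = p * (\<xi> \<bullet> c) + q * (\<phi> \<bullet> c)"
      unfolding p_def q_def HH(3) by (rule \<L>[OF HH(2) c(1)])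
    have "\<eta> \<bullet> v3 a b c = m a b * (\<eta> \<bullet> c) + (m b c * (\<eta> \<bullet> a) + m c a * (\<eta> \<bullet> b))"
      by (simp add: v3_def inner_add_right)
    also have "\<dots> = 0"
      unfolding la lb lc m_eq by (simp add: algebra_simps)
    finally have "\<eta> \<bullet> v3 a b c = 0" .
    moreover have "c \<notin> span (insert a (insert b Q))" using H_eq[OF HH(1) ab] c(2) by simp
    ultimately show False using \<eta>[of a b c] ab c(1) by blast
  qed
  interpret point_lines "x ` A" h "\<L> ` \<H>"
    by unfold_locales (use A \<H> in auto)
  have "real (card (\<L> ` \<H>)) \<le> 576 * (real (card (x ` A)) ^ 2 / t ^ 3 + real (card (x ` A)) / t)"
  proof (rule szemeredi_trotter[OF _ t])
    fix L assume "L \<in> \<L> ` \<H>"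
    then obtain H where H: "H \<in> \<H>" "L = \<L> H" by auto
    have "x ` (A \<inter> H) \<subseteq> on_line L"
      using \<L>[OF H(1)] h_line unfolding H(2) on_line_def by blast
    then have "card (x ` (A \<inter> H)) \<le> card (on_line L)"
      by (rule card_mono[rotated]) (use A in \<open>auto simp: on_line_def\<close>)
    moreover have "card (x ` (A \<inter> H)) = card (A \<inter> H)"
      by (intro card_image inj_on_subset[OF x_inj]) auto
    ultimately show "t \<le> real (card (on_line L))" using rich[OF H(1)] by linarith
  qed
  then show ?thesis by (simp add: card_image x_inj \<L>_inj)
qed

section \<open>Nondegenerate flats\<close>

text \<open>Distinct points of projective space, given by one vector each. Ranks are linear
  dimensions, so a line has rank 2.\<close>

definition point_config :: "'a::euclidean_space set \<Rightarrow> bool" where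
  "point_config P \<longleftrightarrow> finite P \<and> 0 \<notin> P \<and> (\<forall>x\<in>P. \<forall>y\<in>P. x \<noteq> y \<longrightarrow> y \<notin> span {x})"

definition flats :: "'a::euclidean_space set \<Rightarrow> nat \<Rightarrow> 'a set set" where
  "flats P m = {F. F = span (P \<inter> F) \<and> dim F = m}"

text \<open>Single points are exempt, so for a configuration of points every flat of rank 2 is
  nondegenerate, however few points it has.\<close>

definition nondeg :: "real \<Rightarrow> 'a::euclidean_space set \<Rightarrow> 'a set \<Rightarrow> bool" where
  "nondeg \<gamma> P F \<longleftrightarrow> (\<forall>X\<subseteq>P \<inter> F. 2 \<le> card X \<longrightarrow> dim X < dim F \<longrightarrow>
     real (card X) \<le> \<gamma> * real (card (P \<inter> F)))"

definition rich_flats :: "real \<Rightarrow> 'a::euclidean_space set \<Rightarrow> nat \<Rightarrow> real \<Rightarrow> 'a set set" where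
  "rich_flats \<gamma> P m s = {F \<in> flats P m. nondeg \<gamma> P F \<and> s \<le> real (card (P \<inter> F))}"

text \<open>A predicate, so that the induction on the rank can refer to it for several ranks and
  constants. For \<open>m = 2\<close> it has the form of the Szemeredi-Trotter bound.\<close>

definition flat_bound :: "'a::euclidean_space itself \<Rightarrow> real \<Rightarrow> real \<Rightarrow> nat \<Rightarrow> bool" where
  "flat_bound _ \<gamma> C m \<longleftrightarrow> (\<forall>(P :: 'a set) s. point_config P \<longrightarrow> 0 < s \<longrightarrow>
     real (card (rich_flats \<gamma> P m s)) \<le>
       C * (real (card P) ^ m / s ^ (m + 1) + real (card P) ^ (m - 1) / s ^ (m - 1)))"

lemma point_config_finite: "point_config P \<Longrightarrow> finite P"
  by (simp add: point_config_def)

lemma point_config_subset: "point_config P \<Longrightarrow> Q \<subseteq> P \<Longrightarrow> point_config Q"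
  unfolding point_config_def by (meson finite_subset subsetD)

lemma point_config_dim:
  assumes "point_config P" "X \<subseteq> P" "2 \<le> card X"
  shows "2 \<le> dim X"
proof -
  have "finite X" using assms by (auto simp: point_config_def intro: finite_subset)
  then obtain x y where xy: "x \<in> X" "y \<in> X" "x \<noteq> y"
    using card_le_Suc0_iff_eq[of X] assms(3) by fastforce
  then have "y \<notin> span {x}" "x \<noteq> 0" using assms(1,2) by (auto simp: point_config_def)
  then have "independent {y, x}" by (simp add: independent_insert)
  then have "card {y, x} \<le> dim X" by (rule independent_card_le_dim[rotated]) (use xy in auto)
  then show ?thesis using xy by simp
qed

lemma flatsD:
  assumes "F \<in> flats P m"
  shows "span (P \<inter> F) = F" "dim F = m"
  using assms by (simp_all add: flats_def)

lemma flats_subspace: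
  assumes "F \<in> flats P m"
  shows "subspace F"
  using subspace_span[of "P \<inter> F"] unfolding flatsD(1)[OF assms] .

lemma span_in_flats:
  assumes "X \<subseteq> P"
  shows "span X \<in> flats P (dim X)"
proof -
  have "span (P \<inter> span X) = span X"
  proof
    show "span (P \<inter> span X) \<subseteq> span X" by (intro span_minimal) auto
    show "span X \<subseteq> span (P \<inter> span X)" using assms by (intro span_mono) (auto intro: span_base)
  qed
  then show ?thesis by (simp add: flats_def dim_span)
qed

lemma flats_basis:
  assumes "F \<in> flats P m"
  obtains B where "B \<subseteq> P" "independent B" "card B = m" "F = span B"
proof -
  note F = flatsD[OF assms]
  obtain B where B: "B \<subseteq> P \<inter> F" "independent B" "P \<inter> F \<subseteq> span B" "card B = dim (P \<inter> F)"
    using basis_exists[of "P \<inter> F"] by blast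
  have "dim (P \<inter> F) = m" using F by (metis dim_span)
  moreover have "F = span B"
    using F B by (metis inf.bounded_iff span_eq span_superset subset_trans)
  ultimately show thesis using that[of B] B by auto
qed

text \<open>A flat of rank \<open>m\<close> is spanned by an \<open>m\<close>-tuple from
  \<open>P\<close>. The crude bound serves when \<open>s\<close> is below a constant.\<close>

lemma card_flats_le:
  assumes "finite P"
  shows "finite (flats P m)" "card (flats P m) \<le> card P ^ m"
proof -
  have sub: "flats P m \<subseteq> (\<lambda>f. span (f ` {..<m})) ` ({..<m} \<rightarrow>\<^sub>E P)"
  proof
    fix F assume "F \<in> flats P m"
    then obtain B where B: "B \<subseteq> P" "independent B" "card B = m" "F = span B" by (rule flats_basis)
    have "finite B" using B(1) assms finite_subset by blast
    then obtain h where h: "bij_betw h {..<m} B"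
      using ex_bij_betw_nat_finite[of B] B(3) by (auto simp: atLeast0LessThan)
    then have "h ` {..<m} = B" by (simp add: bij_betw_def)
    then have "restrict h {..<m} ` {..<m} = B" by simp
    moreover from this have "restrict h {..<m} \<in> {..<m} \<rightarrow>\<^sub>E P" using B(1) by auto
    ultimately show "F \<in> (\<lambda>f. span (f ` {..<m})) ` ({..<m} \<rightarrow>\<^sub>E P)"
      using B(4) by (metis imageI)
  qed
  have fin: "finite ({..<m} \<rightarrow>\<^sub>E P)" using assms by (intro finite_PiE) auto
  then show "finite (flats P m)" using sub finite_subset by blast
  have "card (flats P m) \<le> card ({..<m} \<rightarrow>\<^sub>E P)"
    using card_mono[OF finite_imageI[OF fin] sub] card_image_le[OF fin] le_trans by blast
  then show "card (flats P m) \<le> card P ^ m" by (simp add: card_PiE)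
qed

lemma rich_flats_subset: "rich_flats \<gamma> P m s \<subseteq> flats P m"
  by (auto simp: rich_flats_def)

lemma nondeg_mono: "nondeg \<gamma> P F \<Longrightarrow> \<gamma> \<le> \<gamma>' \<Longrightarrow> nondeg \<gamma>' P F"
  unfolding nondeg_def by (meson mult_right_mono of_nat_0_le_iff order_trans)

lemma flat_bound_mono:
  assumes "flat_bound TYPE('a::euclidean_space) \<gamma> C m" "\<gamma>' \<le> \<gamma>" "C \<le> C'"
  shows "flat_bound TYPE('a) \<gamma>' C' m"
  unfolding flat_bound_def
proof (intro allI impI)
  fix P :: "'a set" and s :: real
  assume P: "point_config P" and s: "0 < s"
  let ?b = "real (card P) ^ m / s ^ (m + 1) + real (card P) ^ (m - 1) / s ^ (m - 1)"
  have "real (card (rich_flats \<gamma>' P m s)) \<le> real (card (rich_flats \<gamma> P m s))"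
    using card_flats_le(1)[OF point_config_finite[OF P]] nondeg_mono[OF _ assms(2)]
    by (intro of_nat_mono card_mono) (auto simp: rich_flats_def)
  also have "\<dots> \<le> C * ?b" using assms(1) P s by (simp add: flat_bound_def)
  also have "\<dots> \<le> C' * ?b" using assms(3) s by (intro mult_right_mono) auto
  finally show "real (card (rich_flats \<gamma>' P m s)) \<le> C' * ?b" .
qed

text \<open>If \<open>F\<close> is degenerate, some set of smaller rank has more than a fraction
  \<gamma> of its points; descend to the span of that set. The rank drops each time, so at most
  \<open>R\<close> factors \<gamma> are lost.\<close>

lemma exists_nondeg_subflat:
  assumes P: "point_config P" and \<gamma>: "0 < \<gamma>" "\<gamma> \<le> 1"
  shows "F \<in> flats P R \<Longrightarrow> 2 \<le> card (P \<inter> F) \<Longrightarrow>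
    \<exists>j F'. 2 \<le> j \<and> j \<le> R \<and> F' \<in> flats P j \<and> F' \<subseteq> F \<and> nondeg \<gamma> P F' \<and> 2 \<le> card (P \<inter> F') \<and>
      \<gamma> ^ R * real (card (P \<inter> F)) \<le> real (card (P \<inter> F'))"
proof (induction R arbitrary: F rule: less_induct)
  case (less R)
  note F = flatsD[OF less.prems(1)] flats_subspace[OF less.prems(1)]
  show ?case
  proof (cases "nondeg \<gamma> P F")
    case True
    have "2 \<le> dim (P \<inter> F)" by (rule point_config_dim[OF P _ less.prems(2)]) simp
    also have "\<dots> = R" using F by (metis dim_span)
    finally have "2 \<le> R" .
    moreover have "\<gamma> ^ R * real (card (P \<inter> F)) \<le> 1 * real (card (P \<inter> F))"
      using \<gamma> by (intro mult_right_mono power_le_one) auto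
    ultimately show ?thesis using True less.prems by (intro exI[of _ R] exI[of _ F]) auto
  next
    case False
    then obtain X where X: "X \<subseteq> P \<inter> F" "2 \<le> card X" "dim X < R"
      "\<gamma> * real (card (P \<inter> F)) < real (card X)"
      unfolding nondeg_def F(2) not_all not_imp not_le by blast
    have XF: "span X \<subseteq> F" using X(1) F(3) by (intro span_minimal) auto
    have "finite (P \<inter> span X)" using point_config_finite[OF P] by simp
    then have le: "card X \<le> card (P \<inter> span X)"
      using X(1) by (intro card_mono) (auto intro: span_base)
    obtain j F' where F': "2 \<le> j" "j \<le> dim X" "F' \<in> flats P j" "F' \<subseteq> span X" "nondeg \<gamma> P F'"
      "2 \<le> card (P \<inter> F')" "\<gamma> ^ dim X * real (card (P \<inter> span X)) \<le> real (card (P \<inter> F'))"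
      using less.IH[OF X(3), of "span X"] span_in_flats[of X P] X le by fastforce
    have "\<gamma> ^ R \<le> \<gamma> ^ Suc (dim X)" using X(3) \<gamma> by (intro power_decreasing) auto
    then have "\<gamma> ^ R * real (card (P \<inter> F)) \<le> \<gamma> ^ dim X * (\<gamma> * real (card (P \<inter> F)))"
      using mult_right_mono[of "\<gamma> ^ R" "\<gamma> ^ Suc (dim X)" "real (card (P \<inter> F))"]
      by (simp add: mult.left_commute mult.assoc)
    also have "\<dots> \<le> \<gamma> ^ dim X * real (card (P \<inter> span X))"
      using X(4) le \<gamma> by (intro mult_left_mono) auto
    finally show ?thesis using F' X(3) XF by (intro exI[of _ j] exI[of _ F']) auto
  qed
qed

section \<open>Counting tuples by the size of a nondegenerate subflat of their span\<close>

lemma card_partially_determined: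
  fixes G :: "('i \<Rightarrow> 'a) \<Rightarrow> 'a set"
  assumes "finite T" "I \<subseteq> T" "finite P" "0 \<le> M"
  shows "real (card {f \<in> T \<rightarrow>\<^sub>E P. real (card (P \<inter> G (restrict f I))) \<le> M \<and>
      (\<forall>i\<in>T - I. f i \<in> G (restrict f I))}) \<le> real (card P) ^ card I * M ^ card (T - I)"
    (is "real (card ?A) \<le> _")
proof -
  define \<G> where "\<G> = {g \<in> I \<rightarrow>\<^sub>E P. real (card (P \<inter> G g)) \<le> M}"
  have finI: "finite I" using assms finite_subset by blast
  have fin: "finite \<G>" "card \<G> \<le> card P ^ card I"
  proof -
    have f: "finite (I \<rightarrow>\<^sub>E P)" using finI assms by (intro finite_PiE) auto
    show "finite \<G>" using f by (simp add: \<G>_def)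
    have "card \<G> \<le> card (I \<rightarrow>\<^sub>E P)" using f by (intro card_mono) (auto simp: \<G>_def)
    then show "card \<G> \<le> card P ^ card I" using finI by (simp add: card_PiE)
  qed
  let ?S = "SIGMA g:\<G>. (T - I) \<rightarrow>\<^sub>E (P \<inter> G g)"
  have "card ?A \<le> card ?S"
  proof (rule card_inj_on_le)
    show "(\<lambda>f. (restrict f I, restrict f (T - I))) ` ?A \<subseteq> ?S"
      using assms(2) by (auto simp: \<G>_def)
    show "finite ?S" using fin assms by (intro finite_SigmaI finite_PiE) auto
    show "inj_on (\<lambda>f. (restrict f I, restrict f (T - I))) ?A"
    proof (rule inj_onI)
      fix f g assume *: "f \<in> ?A" "g \<in> ?A"
        "(restrict f I, restrict f (T - I)) = (restrict g I, restrict g (T - I))"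
      then have "restrict f I i = restrict g I i" "restrict f (T - I) i = restrict g (T - I) i" for i
        by simp_all
      then have "f i = g i" if "i \<in> T" for i using that by (metis DiffI restrict_apply)
      then show "f = g" using * by (auto intro: PiE_ext)
    qed
  qed
  then have "real (card ?A) \<le> real (card ?S)" by simp
  also have "\<dots> = (\<Sum>g\<in>\<G>. real (card (P \<inter> G g)) ^ card (T - I))"
    using fin assms by (subst card_SigmaI) (auto simp: card_PiE intro!: finite_PiE)
  also have "\<dots> \<le> (\<Sum>g\<in>\<G>. M ^ card (T - I))"
    by (intro sum_mono power_mono) (auto simp: \<G>_def)
  also have "\<dots> \<le> real (card P) ^ card I * M ^ card (T - I)"
    using fin(2) assms(4) by (auto intro!: mult_right_mono simp flip: of_nat_power)
  finally show ?thesis .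
qed

text \<open>Basis extension: a basis of \<open>F\<close> is completed to one of the span of all
  entries by entries of \<open>f\<close>, one index for each.\<close>

lemma extend_by_indices:
  fixes F :: "'a::euclidean_space set"
  assumes "finite T" "F \<subseteq> span (f ` T)"
  obtains I where "I \<subseteq> T" "card I + dim F = dim (f ` T)" "f ` T \<subseteq> span (F \<union> f ` I)"
proof -
  obtain B0 where B0: "B0 \<subseteq> F" "independent B0" "F \<subseteq> span B0" "card B0 = dim F"
    using basis_exists[of F] by blast
  obtain B where B: "B0 \<subseteq> B" "B \<subseteq> B0 \<union> f ` T" "independent B" "B0 \<union> f ` T \<subseteq> span B"
    using maximal_independent_subset_extend[of B0 "B0 \<union> f ` T"] B0 by blast
  have "B - B0 \<subseteq> f ` T" using B by auto
  then obtain I where I: "I \<subseteq> T" "inj_on f I" "B - B0 = f ` I" by (auto simp: subset_image_inj)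
  have finB: "finite B" using B(3) finiteI_independent by blast
  have "card B = dim (f ` T)"
  proof -
    have "span B = span (f ` T)"
    proof
      show "span B \<subseteq> span (f ` T)" using B(2) B0(1) assms(2)
        by (intro span_minimal) (auto intro: span_base)
      show "span (f ` T) \<subseteq> span B" using B(4) by (intro span_minimal) auto
    qed
    then show ?thesis using B(3) by (metis dim_eq_card dim_span)
  qed
  moreover have "card B = card I + card B0"
    using I B(1) finB by (metis card_Diff_subset card_image card_mono finite_subset le_add_diff_inverse2)
  moreover have "f ` T \<subseteq> span (F \<union> f ` I)"
  proof -
    have "B \<subseteq> F \<union> f ` I" using I B0(1) by auto
    then show ?thesis using B(4) span_mono by blast
  qed
  ultimately show thesis using that I B0(4) by simp
qed

lemma real_card_UN_le:
  assumes "finite I" "\<And>i. i \<in> I \<Longrightarrow> real (card (A i)) \<le> b i"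
  shows "real (card (\<Union>i\<in>I. A i)) \<le> (\<Sum>i\<in>I. b i)"
proof -
  have "real (card (\<Union>i\<in>I. A i)) \<le> (\<Sum>i\<in>I. real (card (A i)))"
    using card_UN_le[OF assms(1), of A] by (simp flip: of_nat_sum)
  also have "\<dots> \<le> (\<Sum>i\<in>I. b i)" by (intro sum_mono assms(2))
  finally show ?thesis .
qed

text \<open>For \<open>a \<le> b\<close>, the dyadic intervals from \<open>2 ^ i\<close> to
  \<open>2 ^ (i + 1)\<close> that meet the range from \<open>a\<close> to \<open>b\<close>. Sizes
  are at least 2, so \<open>i\<close> starts at 1, which bounds the number of scales by the
  logarithm of \<open>b\<close> without an additive constant.\<close>

definition scales :: "real \<Rightarrow> real \<Rightarrow> nat set" where
  "scales a b = {i. 1 \<le> i \<and> a < 2 ^ (i + 1) \<and> (2::real) ^ i \<le> b}"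

lemma finite_scales: "finite (scales a b)"
proof (rule finite_subset)
  show "scales a b \<subseteq> {..nat \<lceil>b\<rceil>}"
  proof
    fix i assume "i \<in> scales a b"
    then have "(2::real) ^ i \<le> b" by (simp add: scales_def)
    moreover have "real i < 2 ^ i" by (rule of_nat_less_two_power)
    ultimately have "i \<le> nat \<lceil>b\<rceil>" by linarith
    then show "i \<in> {..nat \<lceil>b\<rceil>}" by simp
  qed
qed simp

definition spanning_tuples :: "'a::euclidean_space set \<Rightarrow> nat \<Rightarrow> nat \<Rightarrow> real \<Rightarrow> real \<Rightarrow> (nat \<Rightarrow> 'a) set"
  where "spanning_tuples P t R a b = {f \<in> {..<t} \<rightarrow>\<^sub>E P. dim (f ` {..<t}) = R \<and>
    a \<le> real (card (P \<inter> span (f ` {..<t}))) \<and> real (card (P \<inter> span (f ` {..<t}))) \<le> b}"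

text \<open>A tuple is charged to a nondegenerate flat carrying a positive fraction of the points of its
  span, the dyadic size of that flat, and the positions of the entries that complete the flat to the
  span. Only those entries are chosen freely from \<open>P\<close>.\<close>

lemma spanning_tuples_cover:
  fixes P :: "'a::euclidean_space set"
  assumes P: "point_config P" and \<gamma>: "0 < \<gamma>" "\<gamma> \<le> 1" and "2 \<le> a"
  shows "spanning_tuples P t R a b \<subseteq>
    (\<Union>i\<in>scales (\<gamma> ^ R * a) b. \<Union>j\<in>{2..R}. \<Union>F\<in>rich_flats \<gamma> P j (2 ^ i).
      \<Union>I\<in>{I. I \<subseteq> {..<t} \<and> card I = R - j}.
        {f \<in> {..<t} \<rightarrow>\<^sub>E P. real (card (P \<inter> span (F \<union> restrict f I ` I))) \<le> 2 ^ (i + 1) / \<gamma> ^ R \<and>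
          (\<forall>k\<in>{..<t} - I. f k \<in> span (F \<union> restrict f I ` I))})"
proof
  fix f assume f: "f \<in> spanning_tuples P t R a b"
  let ?G = "span (f ` {..<t})"
  have f1: "f \<in> {..<t} \<rightarrow>\<^sub>E P" "dim (f ` {..<t}) = R" "a \<le> real (card (P \<inter> ?G))"
    "real (card (P \<inter> ?G)) \<le> b"
    using f by (auto simp: spanning_tuples_def)
  have G: "?G \<in> flats P R" using span_in_flats[of "f ` {..<t}" P] f1(1,2) by auto
  have "2 \<le> card (P \<inter> ?G)" using f1(3) assms(4) by linarith
  then obtain j F where F: "2 \<le> j" "j \<le> R" "F \<in> flats P j" "F \<subseteq> ?G" "nondeg \<gamma> P F"
    "2 \<le> card (P \<inter> F)" "\<gamma> ^ R * real (card (P \<inter> ?G)) \<le> real (card (P \<inter> F))"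
    using exists_nondeg_subflat[OF P \<gamma> G] by blast
  define c where "c = card (P \<inter> F)"
  obtain i where i: "2 ^ i \<le> c" "c < 2 ^ (i + 1)"
    using ex_power_ivl1[of 2 c] F(6) by (auto simp: c_def)
  have ri: "2 ^ i \<le> real c" "real c < 2 ^ (i + 1)"
    using i[folded of_nat_le_iff[where 'a = real] of_nat_less_iff[where 'a = real]] by simp_all
  have "i \<noteq> 0" using i(2) F(6) by (cases i) (auto simp: c_def)
  have finP: "finite P" by (rule point_config_finite[OF P])
  have "\<gamma> ^ R * a \<le> \<gamma> ^ R * real (card (P \<inter> ?G))" using f1(3) \<gamma> by (intro mult_left_mono) auto
  also have "\<dots> < 2 ^ (i + 1)" using F(7) ri(2) by (simp add: c_def)
  finally have "\<gamma> ^ R * a < 2 ^ (i + 1)" .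
  moreover have "c \<le> card (P \<inter> ?G)" unfolding c_def using F(4) finP by (intro card_mono) auto
  then have "2 ^ i \<le> b" using ri(1) f1(4) by linarith
  ultimately have sc: "i \<in> scales (\<gamma> ^ R * a) b"
    using \<open>i \<noteq> 0\<close> by (simp add: scales_def)
  have rich: "F \<in> rich_flats \<gamma> P j (2 ^ i)" using F ri by (simp add: rich_flats_def c_def)
  obtain I where I: "I \<subseteq> {..<t}" "card I + dim F = dim (f ` {..<t})" "f ` {..<t} \<subseteq> span (F \<union> f ` I)"
    by (rule extend_by_indices[OF _ F(4)]) auto
  have "dim F = j" using flatsD F(3) by blast
  then have cI: "card I = R - j" using I(2) f1(2) by simp
  have res: "restrict f I ` I = f ` I" by auto
  have "span (F \<union> f ` I) \<subseteq> ?G" using F(4) I(1) by (intro span_minimal) (auto intro: span_base)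
  then have "card (P \<inter> span (F \<union> f ` I)) \<le> card (P \<inter> ?G)" using finP by (intro card_mono) auto
  also have "real (card (P \<inter> ?G)) \<le> 2 ^ (i + 1) / \<gamma> ^ R"
    using F(7) ri(2) \<gamma> by (simp add: c_def field_simps)
  finally have "real (card (P \<inter> span (F \<union> f ` I))) \<le> 2 ^ (i + 1) / \<gamma> ^ R" by simp
  then have "f \<in> {f \<in> {..<t} \<rightarrow>\<^sub>E P. real (card (P \<inter> span (F \<union> restrict f I ` I))) \<le> 2 ^ (i + 1) / \<gamma> ^ R \<and>
      (\<forall>k\<in>{..<t} - I. f k \<in> span (F \<union> restrict f I ` I))}"
    using f1(1) I(3) unfolding res by auto
  moreover have "I \<in> {I. I \<subseteq> {..<t} \<and> card I = R - j}" "j \<in> {2..R}" using I cI F by auto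
  ultimately show "f \<in> (\<Union>i\<in>scales (\<gamma> ^ R * a) b. \<Union>j\<in>{2..R}. \<Union>F\<in>rich_flats \<gamma> P j (2 ^ i).
      \<Union>I\<in>{I. I \<subseteq> {..<t} \<and> card I = R - j}.
        {f \<in> {..<t} \<rightarrow>\<^sub>E P. real (card (P \<inter> span (F \<union> restrict f I ` I))) \<le> 2 ^ (i + 1) / \<gamma> ^ R \<and>
          (\<forall>k\<in>{..<t} - I. f k \<in> span (F \<union> restrict f I ` I))})"
    using sc rich by blast
qed

text \<open>The \<open>R - j\<close> free entries raise the power of \<open>n\<close> to one
  independent of \<open>j\<close>, and the remaining \<open>(t - R) + j\<close> entries do the same
  for the power of \<open>s\<close>. Only the power of \<open>q\<close> still depends on
  \<open>j\<close>, and \<open>q ^ t\<close> dominates it.\<close>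

lemma scale_term_bound:
  fixes n s q :: real
  assumes "0 \<le> n" "0 < s" "1 \<le> q" "0 \<le> C" "2 \<le> j" "j \<le> R" "R \<le> t"
  shows "C * (n ^ j / s ^ (j + 1) + n ^ (j - 1) / s ^ (j - 1)) * (2 ^ t * (n ^ (R - j) * (q * s) ^ (t - (R - j))))
    \<le> 2 ^ t * C * q ^ t * (s ^ (t - R) * (n ^ R / s + n ^ (R - 1) * s))"
proof -
  have t: "t - (R - j) = (t - R) + j" using assms by simp
  have "q ^ (t - R + j) \<le> q ^ t" using assms by (intro power_increasing) auto
  have n: "n ^ j * n ^ (R - j) = n ^ R" "n ^ (j - 1) * n ^ (R - j) = n ^ (R - 1)"
    using assms by (simp_all flip: power_add)
  have s: "s ^ (t - R + j) / s ^ (j + 1) = s ^ (t - R) / s" "s ^ (t - R + j) / s ^ (j - 1) = s ^ (t - R) * s"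
  proof -
    show "s ^ (t - R + j) / s ^ (j + 1) = s ^ (t - R) / s" using assms(2) by (simp add: power_add)
    have "s ^ j = s ^ (j - 1) * s" using assms(5) by (cases j) auto
    then show "s ^ (t - R + j) / s ^ (j - 1) = s ^ (t - R) * s" using assms(2) by (simp add: power_add)
  qed
  have "C * (n ^ j / s ^ (j + 1) + n ^ (j - 1) / s ^ (j - 1)) * (2 ^ t * (n ^ (R - j) * (q * s) ^ (t - (R - j))))
    = 2 ^ t * C * q ^ (t - R + j) * ((n ^ j * n ^ (R - j)) * (s ^ (t - R + j) / s ^ (j + 1)) +
       (n ^ (j - 1) * n ^ (R - j)) * (s ^ (t - R + j) / s ^ (j - 1)))"
    unfolding t by (simp add: power_mult_distrib algebra_simps)
  also have "\<dots> = 2 ^ t * C * q ^ (t - R + j) * (s ^ (t - R) * (n ^ R / s + n ^ (R - 1) * s))"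
    unfolding n s by (simp add: algebra_simps)
  also have "\<dots> \<le> 2 ^ t * C * q ^ t * (s ^ (t - R) * (n ^ R / s + n ^ (R - 1) * s))"
    using \<open>q ^ (t - R + j) \<le> q ^ t\<close> assms by (intro mult_right_mono mult_left_mono) auto
  finally show ?thesis .
qed

text \<open>In the prefactor, \<open>R\<close> counts the ranks \<open>j\<close>,
  \<open>2 ^ t\<close> the position sets \<open>I\<close>, and \<open>C\<close> comes from the flat
  bound.\<close>

lemma card_spanning_tuples:
  fixes P :: "'a::euclidean_space set"
  assumes fb: "\<And>j. 2 \<le> j \<Longrightarrow> j \<le> R \<Longrightarrow> flat_bound TYPE('a) \<gamma> C j"
    and \<gamma>: "0 < \<gamma>" "\<gamma> \<le> 1" and C: "0 \<le> C" and P: "point_config P" and a: "2 \<le> a" and R: "R \<le> t"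
  shows "real (card (spanning_tuples P t R a b)) \<le> real R * (2 ^ t * C * (2 / \<gamma> ^ R) ^ t) *
    (\<Sum>i\<in>scales (\<gamma> ^ R * a) b. (2 ^ i) ^ (t - R) *
      (real (card P) ^ R / 2 ^ i + real (card P) ^ (R - 1) * 2 ^ i))"
proof -
  define n where "n = real (card P)"
  \<comment> \<open>A span charged to a flat at scale \<open>2 ^ i\<close> has at most
    \<open>q * 2 ^ i\<close> points.\<close>
  define q where "q = 2 / \<gamma> ^ R"
  have finP: "finite P" by (rule point_config_finite[OF P])
  have q: "1 \<le> q"
  proof -
    have "\<gamma> ^ R \<le> 2" using power_le_one[of \<gamma> R] \<gamma> by linarith
    then show ?thesis using \<gamma> by (simp add: q_def field_simps)
  qed
  define Z where "Z i F I = {f \<in> {..<t} \<rightarrow>\<^sub>E P. real (card (P \<inter> span (F \<union> restrict f I ` I))) \<le> 2 ^ (i + 1) / \<gamma> ^ R \<and>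
          (\<forall>k\<in>{..<t} - I. f k \<in> span (F \<union> restrict f I ` I))}" for i F I
  define \<I> where "\<I> j = {I. I \<subseteq> {..<t} \<and> card I = R - j}" for j
  define bd where "bd i = 2 ^ t * C * q ^ t * ((2 ^ i) ^ (t - R) * (n ^ R / 2 ^ i + n ^ (R - 1) * 2 ^ i))" for i
  have fin\<I>: "finite (\<I> j)" for j by (rule finite_subset[of _ "Pow {..<t}"]) (auto simp: \<I>_def)
  have card\<I>: "real (card (\<I> j)) \<le> 2 ^ t" for j
  proof -
    have "card (\<I> j) \<le> card (Pow {..<t})" by (rule card_mono) (auto simp: \<I>_def)
    then have "real (card (\<I> j)) \<le> real (2 ^ t)" unfolding of_nat_le_iff by (simp add: card_Pow)
    then show ?thesis by simp
  qed
  have Z: "real (card (Z i F I)) \<le> n ^ (R - j) * (q * 2 ^ i) ^ (t - (R - j))" if "I \<in> \<I> j" for i F I j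
  proof -
    have I: "I \<subseteq> {..<t}" "card I = R - j" using that by (auto simp: \<I>_def)
    have "finite I" using I(1) finite_subset by blast
    then have "card ({..<t} - I) = t - (R - j)" using I by (simp add: card_Diff_subset)
    moreover have "2 ^ (i + 1) / \<gamma> ^ R = q * 2 ^ i" by (simp add: q_def)
    ultimately show ?thesis
      using card_partially_determined[OF _ I(1) finP, of "2 ^ (i + 1) / \<gamma> ^ R"
          "\<lambda>g. span (F \<union> g ` I)"] \<gamma> q I(2) unfolding Z_def n_def by simp
  qed
  have bd: "real (card (\<Union>F\<in>rich_flats \<gamma> P j (2 ^ i). \<Union>I\<in>\<I> j. Z i F I)) \<le> bd i" if j: "j \<in> {2..R}" for i j
  proof -
    let ?z = "n ^ (R - j) * (q * 2 ^ i) ^ (t - (R - j))"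
    have z0: "0 \<le> ?z" using q by (simp add: n_def)
    have one: "real (card (\<Union>I\<in>\<I> j. Z i F I)) \<le> 2 ^ t * ?z" for F
    proof -
      have "real (card (\<Union>I\<in>\<I> j. Z i F I)) \<le> (\<Sum>I\<in>\<I> j. ?z)"
        by (rule real_card_UN_le[OF fin\<I> Z])
      also have "\<dots> \<le> 2 ^ t * ?z" using mult_right_mono[OF card\<I> z0] by simp
      finally show ?thesis .
    qed
    have "real (card (\<Union>F\<in>rich_flats \<gamma> P j (2 ^ i). \<Union>I\<in>\<I> j. Z i F I)) \<le>
        (\<Sum>F\<in>rich_flats \<gamma> P j (2 ^ i). 2 ^ t * ?z)"
      by (rule real_card_UN_le[OF finite_subset[OF rich_flats_subset card_flats_le(1)[OF finP]] one])
    also have "\<dots> = real (card (rich_flats \<gamma> P j (2 ^ i))) * (2 ^ t * ?z)" by simp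
    also have "\<dots> \<le> C * (n ^ j / (2 ^ i) ^ (j + 1) + n ^ (j - 1) / (2 ^ i) ^ (j - 1)) * (2 ^ t * ?z)"
    proof (rule mult_right_mono)
      have "flat_bound TYPE('a) \<gamma> C j" using fb j by simp
      then show "real (card (rich_flats \<gamma> P j (2 ^ i))) \<le>
          C * (n ^ j / (2 ^ i) ^ (j + 1) + n ^ (j - 1) / (2 ^ i) ^ (j - 1))"
        using P unfolding flat_bound_def n_def by simp
    qed (use z0 in auto)
    also have "\<dots> \<le> bd i"
      unfolding bd_def using j q C R by (intro scale_term_bound) (auto simp: n_def)
    finally show ?thesis .
  qed
  define U where "U i = (\<Union>j\<in>{2..R}. \<Union>F\<in>rich_flats \<gamma> P j (2 ^ i). \<Union>I\<in>\<I> j. Z i F I)" for i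
  have U: "real (card (U i)) \<le> real R * bd i" for i
  proof -
    have "real (card (U i)) \<le>
        (\<Sum>j\<in>{2..R}. bd i)"
      unfolding U_def by (rule real_card_UN_le[OF _ bd]) auto
    also have "\<dots> \<le> real R * bd i"
    proof -
      have "0 \<le> bd i" using C q by (simp add: bd_def n_def)
      then show ?thesis by (simp add: mult_right_mono)
    qed
    finally show ?thesis .
  qed
  have "real (card (\<Union>i\<in>scales (\<gamma> ^ R * a) b. U i)) \<le> (\<Sum>i\<in>scales (\<gamma> ^ R * a) b. real R * bd i)"
    by (rule real_card_UN_le[OF finite_scales U])
  moreover have "card (spanning_tuples P t R a b) \<le> card (\<Union>i\<in>scales (\<gamma> ^ R * a) b. U i)"
  proof (rule card_mono)
    have "finite (Z i F I)" for i F I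
      unfolding Z_def using finP by (intro finite_subset[OF _ finite_PiE[of "{..<t}" "\<lambda>_. P"]]) auto
    then show "finite (\<Union>i\<in>scales (\<gamma> ^ R * a) b. U i)"
      unfolding U_def
      using fin\<I> finite_subset[OF rich_flats_subset card_flats_le(1)[OF finP]]
      by (intro finite_UN_I finite_scales finite_atLeastAtMost)
    show "spanning_tuples P t R a b \<subseteq> (\<Union>i\<in>scales (\<gamma> ^ R * a) b. U i)"
      using spanning_tuples_cover[OF P \<gamma> a] unfolding U_def Z_def \<I>_def .
  qed
  ultimately have "real (card (spanning_tuples P t R a b)) \<le> (\<Sum>i\<in>scales (\<gamma> ^ R * a) b. real R * bd i)"
    by linarith
  then show ?thesis
    unfolding bd_def sum_distrib_left[symmetric] by (simp add: n_def q_def mult.assoc)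
qed

section \<open>Light tuples\<close>

text \<open>The geometric sum is at most twice its first term, and the least exponent
  \<open>i\<close> satisfies \<open>a < 2 ^ (i + 1)\<close>.\<close>

lemma sum_scales_inverse:
  assumes "0 < a"
  shows "(\<Sum>i\<in>scales a b. 1 / 2 ^ i) \<le> 4 / a"
proof (cases "scales a b = {}")
  case True
  then show ?thesis using assms by simp
next
  case False
  define i0 where "i0 = Min (scales a b)"
  define k where "k = Suc (Max (scales a b)) - i0"
  have i0: "i0 \<in> scales a b" unfolding i0_def by (rule Min_in[OF finite_scales False])
  have geo: "(\<Sum>i\<in>{i0..<i0 + k}. 1 / (2::real) ^ i) = 2 / 2 ^ i0 - 2 / 2 ^ (i0 + k)" for k
  proof (induction k)
    case (Suc k)
    have "(\<Sum>i\<in>{i0..<i0 + Suc k}. 1 / (2::real) ^ i) = 2 / 2 ^ i0 - 2 / 2 ^ (i0 + k) + 1 / 2 ^ (i0 + k)"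
      using Suc by simp
    then show ?case by simp
  qed simp
  have "i0 \<le> Max (scales a b)" using i0 finite_scales by (intro Max_ge)
  then have "scales a b \<subseteq> {i0..<i0 + k}"
    using finite_scales by (auto simp: i0_def k_def less_Suc_eq_le)
  then have "(\<Sum>i\<in>scales a b. 1 / (2::real) ^ i) \<le> (\<Sum>i\<in>{i0..<i0 + k}. 1 / 2 ^ i)"
    by (intro sum_mono2) auto
  also have "\<dots> \<le> 2 / 2 ^ i0" by (simp add: geo)
  also have "\<dots> \<le> 4 / a" using i0 assms by (simp add: scales_def field_simps)
  finally show ?thesis .
qed

lemma sum_scales_power:
  assumes "0 \<le> b"
  shows "(\<Sum>i\<in>scales a b. 2 ^ i) \<le> 2 * b"
proof (cases "scales a b = {}")
  case True
  then show ?thesis using assms by simp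
next
  case False
  define i1 where "i1 = Max (scales a b)"
  have i1: "i1 \<in> scales a b" unfolding i1_def by (rule Max_in[OF finite_scales False])
  have geo: "(\<Sum>i\<in>{..k}. (2::real) ^ i) = 2 * 2 ^ k - 1" for k by (induction k) auto
  have "scales a b \<subseteq> {..i1}" using finite_scales by (auto simp: i1_def)
  then have "(\<Sum>i\<in>scales a b. (2::real) ^ i) \<le> (\<Sum>i\<in>{..i1}. 2 ^ i)"
    by (intro sum_mono2) auto
  also have "\<dots> \<le> 2 * 2 ^ i1" by (simp add: geo)
  also have "\<dots> \<le> 2 * b" using i1 by (simp add: scales_def)
  finally show ?thesis .
qed

text \<open>Stated for indices rather than for the set of values, so that a repeated entry counts as
  dependent.\<close>

lemma exists_dependent_index:
  fixes f :: "'i \<Rightarrow> 'a::euclidean_space"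
  assumes "finite T" "dim (f ` T) < card T"
  shows "\<exists>k\<in>T. f k \<in> span (f ` (T - {k}))"
proof (rule ccontr)
  assume contra: "\<not> ?thesis"
  have "inj_on f T"
  proof (rule inj_onI, rule ccontr)
    fix k l assume "k \<in> T" "l \<in> T" "f k = f l" "k \<noteq> l"
    then have "f k \<in> f ` (T - {k})" by auto
    then have "f k \<in> span (f ` (T - {k}))" by (rule span_base)
    then show False using contra \<open>k \<in> T\<close> by blast
  qed
  moreover have "independent (f ` T)"
    unfolding dependent_def
  proof clarify
    fix k assume "k \<in> T" "f k \<in> span (f ` T - {f k})"
    moreover have "span (f ` T - {f k}) \<subseteq> span (f ` (T - {k}))" by (rule span_mono) auto
    ultimately show False using contra by blast
  qed
  ultimately show False using assms by (simp add: dim_eq_card_independent card_image)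
qed

text \<open>A Beck-type statement in \<open>H\<close>: few tuples are dependent, since nondegeneracy bounds the number
  of points on proper subspaces, and few independent tuples span a flat with more than \<open>B\<close> points.\<close>

lemma exists_light_tuples:
  assumes m: "2 \<le> m" and fb: "\<forall>j. 2 \<le> j \<and> j < m \<longrightarrow> flat_bound TYPE('a::euclidean_space) \<gamma>\<^sub>0 C j"
    and \<gamma>0: "0 < \<gamma>\<^sub>0" "\<gamma>\<^sub>0 \<le> 1" and C: "0 \<le> C"
  shows "\<exists>\<gamma> B. 0 < \<gamma> \<and> \<gamma> \<le> 1 \<and> 1 \<le> B \<and> (\<forall>(P :: 'a set) H. point_config P \<longrightarrow> H \<in> flats P m \<longrightarrow>
    nondeg \<gamma> P H \<longrightarrow> 1 \<le> \<gamma> * real (card (P \<inter> H)) \<longrightarrow>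
    real (card (P \<inter> H)) ^ (m - 1) / 2 \<le> real (card {f \<in> {..<m - 1} \<rightarrow>\<^sub>E P \<inter> H.
      dim (f ` {..<m - 1}) = m - 1 \<and> real (card (P \<inter> span (f ` {..<m - 1}))) \<le> B}))"
proof -
  define T where "T = {..<m - 1}"
  define K where "K = real (m - 1) * (2 ^ (m - 1) * C * (2 / \<gamma>\<^sub>0 ^ (m - 1)) ^ (m - 1))"
  define \<kappa> where "\<kappa> = \<gamma>\<^sub>0 ^ (m - 1)"
  \<comment> \<open>\<open>B\<close> limits the contribution of the small scales to 1/8 of all
    tuples. The choice of \<gamma> limits that of the large scales to 1/8 and the dependent tuples
    to 1/4, so at least half of the tuples remain.\<close>
  define B where "B = 2 + 32 * K / \<kappa>"
  define \<gamma> where "\<gamma> = 1 / (16 * K + 4 * real m)"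
  have K: "0 \<le> K" using C \<gamma>0 by (simp add: K_def)
  have \<kappa>: "0 < \<kappa>" using \<gamma>0 by (simp add: \<kappa>_def)
  have B: "2 \<le> B" using K \<kappa> by (simp add: B_def)
  have den: "1 \<le> 16 * K + 4 * real m" using K m by linarith
  then have \<gamma>: "0 < \<gamma>" "\<gamma> \<le> 1" by (auto simp: \<gamma>_def)
  have \<gamma>den: "\<gamma> * (16 * K + 4 * real m) = 1" using den by (simp add: \<gamma>_def)
  have KB: "K * (4 / (\<kappa> * B)) \<le> 1 / 8"
  proof -
    have "32 * K \<le> \<kappa> * B" using \<kappa> by (simp add: B_def distrib_left)
    moreover have "0 < \<kappa> * B" using \<kappa> B by simp
    ultimately show ?thesis by (simp add: field_simps)
  qed
  have K\<gamma>: "K * (2 * \<gamma>) + real (m - 1) * \<gamma> \<le> 3 / 8"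
  proof -
    have "K * (2 * \<gamma>) = \<gamma> * (16 * K) / 8" by simp
    also have "\<dots> \<le> \<gamma> * (16 * K + 4 * real m) / 8"
      using \<gamma> by (intro divide_right_mono mult_left_mono) auto
    finally have 1: "K * (2 * \<gamma>) \<le> 1 / 8" unfolding \<gamma>den .
    have "real (m - 1) * \<gamma> \<le> \<gamma> * (16 * K + 4 * real m) / 4"
    proof -
      have "\<gamma> * (4 * real (m - 1)) \<le> \<gamma> * (16 * K + 4 * real m)"
        using \<gamma> K by (intro mult_left_mono) auto
      then show ?thesis by (simp add: mult.commute mult.left_commute)
    qed
    then have "real (m - 1) * \<gamma> \<le> 1 / 4" unfolding \<gamma>den .
    with 1 show ?thesis by linarith
  qed
  have "real (card (P \<inter> H)) ^ (m - 1) / 2 \<le> real (card {f \<in> T \<rightarrow>\<^sub>E P \<inter> H.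
      dim (f ` T) = m - 1 \<and> real (card (P \<inter> span (f ` T))) \<le> B})"
    if P: "point_config P" and H: "H \<in> flats P m" and nd: "nondeg \<gamma> P H"
      and large: "1 \<le> \<gamma> * real (card (P \<inter> H))" for P H :: "'a set"
  proof -
    define X where "X = P \<inter> H"
    define r where "r = real (card X)"
    have X: "point_config X" "finite X"
      using point_config_subset[OF P, of X] point_config_finite by (auto simp: X_def)
    have T: "finite T" "card T = m - 1" by (auto simp: T_def)
    have r: "0 < r" "1 \<le> \<gamma> * r"
    proof -
      show "1 \<le> \<gamma> * r" using large by (simp add: r_def X_def)
      then have "r \<noteq> 0" by auto
      then show "0 < r" by (simp add: r_def)
    qed
    \<comment> \<open>Nondegeneracy says nothing about sets of at most one point; for these the
      assumption \<open>1 \<le> \<gamma> * r\<close> steps in.\<close>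
    have small: "real (card (X \<inter> span Y)) \<le> \<gamma> * r" if "dim Y < m" for Y
    proof (cases "2 \<le> card (X \<inter> span Y)")
      case True
      have "dim (X \<inter> span Y) \<le> dim (span Y)" by (intro dim_subset) auto
      then have "dim (X \<inter> span Y) < dim H" using that flatsD(2)[OF H] by (simp add: dim_span)
      then show ?thesis using nd True unfolding nondeg_def r_def X_def by (meson inf_le1)
    next
      case False
      then show ?thesis using r by linarith
    qed
    have XH: "span (f ` T) \<subseteq> H" if "f \<in> T \<rightarrow>\<^sub>E X" for f
      using that flats_subspace[OF H] by (intro span_minimal) (auto simp: X_def)
    define good where "good = {f \<in> T \<rightarrow>\<^sub>E P \<inter> H.
      dim (f ` T) = m - 1 \<and> real (card (P \<inter> span (f ` T))) \<le> B}"
    \<comment> \<open>Entry \<open>k\<close> lies in the span of the others, which leaves at most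
      \<open>\<gamma> * r\<close> choices for it once these are fixed.\<close>
    define dep where "dep k = {f \<in> T \<rightarrow>\<^sub>E X. real (card (X \<inter> span (restrict f (T - {k}) ` (T - {k})))) \<le> \<gamma> * r \<and>
      (\<forall>i\<in>T - (T - {k}). f i \<in> span (restrict f (T - {k}) ` (T - {k})))}" for k
    have fin: "finite (T \<rightarrow>\<^sub>E X)" using X T by (intro finite_PiE) auto
    have "T \<rightarrow>\<^sub>E X \<subseteq> good \<union> ((\<Union>k\<in>T. dep k) \<union> spanning_tuples X (m - 1) (m - 1) B (\<gamma> * r))"
    proof
      fix f assume f: "f \<in> T \<rightarrow>\<^sub>E X"
      have dle: "dim (f ` S) \<le> card S" if "finite S" for S
        using dim_le_card'[of "f ` S"] card_image_le[OF that, of f] that by simp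
      show "f \<in> good \<union> ((\<Union>k\<in>T. dep k) \<union> spanning_tuples X (m - 1) (m - 1) B (\<gamma> * r))"
      proof (cases "dim (f ` T) < m - 1")
        case True
        then obtain k where k: "k \<in> T" "f k \<in> span (f ` (T - {k}))"
          using exists_dependent_index[of T f] T by auto
        have res: "restrict f (T - {k}) ` (T - {k}) = f ` (T - {k})" by auto
        have "card (T - {k}) < m" using T k(1) m by (simp add: card_Diff_singleton)
        then have "dim (f ` (T - {k})) < m" using dle[of "T - {k}"] T by simp
        then have "f \<in> dep k" using f k small unfolding dep_def res by auto
        then show ?thesis using k(1) by blast
      next
        case False
        then have d: "dim (f ` T) = m - 1" using dle[of T] T by simp
        have PX: "P \<inter> span (f ` T) = X \<inter> span (f ` T)" using XH[OF f] by (auto simp: X_def)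
        have "real (card (X \<inter> span (f ` T))) \<le> \<gamma> * r" using small[of "f ` T"] d m by simp
        then show ?thesis using f d PX
          by (cases "real (card (P \<inter> span (f ` T))) \<le> B")
            (auto simp: good_def spanning_tuples_def X_def T_def)
      qed
    qed
    moreover have "finite (good \<union> ((\<Union>k\<in>T. dep k) \<union> spanning_tuples X (m - 1) (m - 1) B (\<gamma> * r)))"
      by (rule finite_subset[OF _ fin]) (auto simp: good_def dep_def spanning_tuples_def X_def T_def)
    ultimately have "card (T \<rightarrow>\<^sub>E X) \<le>
        card (good \<union> ((\<Union>k\<in>T. dep k) \<union> spanning_tuples X (m - 1) (m - 1) B (\<gamma> * r)))"
      by (rule card_mono[rotated])
    also have "\<dots> \<le> card good + (card (\<Union>k\<in>T. dep k) + card (spanning_tuples X (m - 1) (m - 1) B (\<gamma> * r)))"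
      by (meson add_left_mono card_Un_le order_trans)
    finally have "r ^ (m - 1) \<le> real (card good) +
        (real (card (\<Union>k\<in>T. dep k)) + real (card (spanning_tuples X (m - 1) (m - 1) B (\<gamma> * r))))"
      using T by (simp add: card_PiE r_def flip: of_nat_add of_nat_power)
    moreover have "real (card (\<Union>k\<in>T. dep k)) \<le> (real (m - 1) * \<gamma>) * r ^ (m - 1)"
    proof -
      have "real (card (dep k)) \<le> \<gamma> * r ^ (m - 1)" if k: "k \<in> T" for k
      proof -
        have c: "card (T - {k}) = m - 2" "card (T - (T - {k})) = 1"
          using T k by (auto simp: card_Diff_singleton double_diff)
        have "m - 1 = Suc (m - 2)" using m by simp
        then have "r ^ (m - 1) = r ^ (m - 2) * r" by simp
        then show ?thesis
          using card_partially_determined[OF T(1) _ X(2), of "T - {k}" "\<gamma> * r"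
              "\<lambda>g. span (g ` (T - {k}))"] r(2) c
          unfolding dep_def by (simp add: r_def mult.left_commute)
      qed
      then have "real (card (\<Union>k\<in>T. dep k)) \<le> (\<Sum>k\<in>T. \<gamma> * r ^ (m - 1))"
        by (intro real_card_UN_le T)
      then show ?thesis using T by simp
    qed
    moreover have "real (card (spanning_tuples X (m - 1) (m - 1) B (\<gamma> * r))) \<le>
      (K * (4 / (\<kappa> * B))) * r ^ (m - 1) + (K * (2 * \<gamma>)) * r ^ (m - 1)"
    proof -
      let ?S = "scales (\<kappa> * B) (\<gamma> * r)"
      \<comment> \<open>Length and rank of the tuples agree here, so the factor
        \<open>(2 ^ i) ^ (t - R)\<close> is 1.\<close>
      have "real (card (spanning_tuples X (m - 1) (m - 1) B (\<gamma> * r))) \<le>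
        K * (\<Sum>i\<in>?S. r ^ (m - 1) * (1 / 2 ^ i) + r ^ (m - 2) * 2 ^ i)"
        using card_spanning_tuples[of "m - 1" \<gamma>\<^sub>0 C X B "m - 1" "\<gamma> * r"] fb \<gamma>0 C X(1) B m
        by (simp add: K_def \<kappa>_def r_def numeral_2_eq_2)
      also have "\<dots> = K * (r ^ (m - 1) * (\<Sum>i\<in>?S. 1 / 2 ^ i) + r ^ (m - 2) * (\<Sum>i\<in>?S. 2 ^ i))"
        by (simp add: sum.distrib sum_distrib_left)
      also have "\<dots> \<le> K * (r ^ (m - 1) * (4 / (\<kappa> * B)) + r ^ (m - 2) * (2 * (\<gamma> * r)))"
        using K \<kappa> B r by (intro mult_left_mono add_mono sum_scales_inverse sum_scales_power) auto
      also have "r ^ (m - 2) * (2 * (\<gamma> * r)) = 2 * \<gamma> * r ^ (m - 1)"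
      proof -
        have "m - 1 = Suc (m - 2)" using m by simp
        then have "r ^ (m - 1) = r ^ (m - 2) * r" by simp
        then show ?thesis by (simp add: algebra_simps)
      qed
      finally show ?thesis by (simp add: algebra_simps)
    qed
    moreover have "(K * (4 / (\<kappa> * B))) * r ^ (m - 1) \<le> (1 / 8) * r ^ (m - 1)"
      using KB r by (intro mult_right_mono) auto
    moreover have "(K * (2 * \<gamma>)) * r ^ (m - 1) + (real (m - 1) * \<gamma>) * r ^ (m - 1) \<le> (3 / 8) * r ^ (m - 1)"
      unfolding distrib_right[symmetric] using K\<gamma> r by (intro mult_right_mono) auto
    ultimately have "r ^ (m - 1) / 2 \<le> real (card good)" by linarith
    then show ?thesis by (simp add: good_def r_def X_def)
  qed
  then show ?thesis unfolding T_def using \<gamma> B by (intro exI[of _ \<gamma>] exI[of _ B]) auto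
qed

section \<open>The number of rich nondegenerate flats\<close>

text \<open>Projection from \<open>S\<close> identifies the points with the same \<open>cls\<close>.
  Such a class meets \<open>P\<close> in at most \<open>B\<close> points, so keeping one
  representative of each leaves at least \<open>s / (4 * B)\<close> points in every
  \<open>H\<close>, and \<open>s \<ge> 8 * B\<close> makes this at least 2, as Szemeredi-Trotter
  demands.\<close>

lemma card_rich_through:
  fixes P S :: "'a::euclidean_space set" and B s :: real
  defines "A \<equiv> {a\<in>P. dim (insert a S) = Suc (dim S) \<and> real (card (P \<inter> span (insert a S))) \<le> B}"
  assumes P: "finite P" and B: "1 \<le> B" and s: "8 * B \<le> s"
    and \<H>: "finite \<H>" "\<And>H. H \<in> \<H> \<Longrightarrow> subspace H \<and> S \<subseteq> H \<and> dim H = dim S + 2"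
    and rich: "\<And>H. H \<in> \<H> \<Longrightarrow> s / 4 \<le> real (card (A \<inter> H))"
  shows "real (card \<H>) \<le>
    576 * (real (card P) ^ 2 / (s / (4 * B)) ^ 3 + real (card P) / (s / (4 * B)))"
proof -
  define cls where "cls a = span (insert a S)" for a
  define rep where "rep c = (SOME a. a \<in> A \<and> cls a = c)" for c
  define A' where "A' = rep ` cls ` A"
  define t where "t = s / (4 * B)"
  have t: "2 \<le> t" using B s by (simp add: t_def field_simps)
  have rep: "rep (cls a) \<in> A" "cls (rep (cls a)) = cls a" if "a \<in> A" for a
    using someI[of "\<lambda>x. x \<in> A \<and> cls x = cls a" a] that by (auto simp: rep_def)
  have rep_A': "rep (cls a) = a" if "a \<in> A'" for a
    using that rep by (auto simp: A'_def)
  have A'A: "A' \<subseteq> A" using rep by (auto simp: A'_def)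
  have finA: "finite A" using P by (simp add: A_def)
  have dim_cls: "dim (cls a) = Suc (dim S)" if "a \<in> A" for a
    using that by (simp add: A_def cls_def dim_span)
  have span_S: "span (insert a (span S)) = cls a" for a
  proof
    show "span (insert a (span S)) \<subseteq> cls a"
      unfolding cls_def using span_mono[of S "insert a S"]
      by (intro span_minimal) (auto intro: span_base)
    show "cls a \<subseteq> span (insert a (span S))"
      unfolding cls_def by (intro span_mono) (auto intro: span_base)
  qed
  have "real (card \<H>) \<le> 576 * (real (card A') ^ 2 / t ^ 3 + real (card A') / t)"
  proof (rule szemeredi_trotter_projective[of "span S"])
    show "finite A'" using A'A finA finite_subset by blast
    show "A' \<inter> span S = {}"
    proof -
      have "a \<notin> span S" if "a \<in> A" for a
        using that dim_insert[of a S] by (auto simp: A_def)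
      then show ?thesis using A'A by blast
    qed
    show "b \<notin> span (insert a (span S))" if ab: "a \<in> A'" "b \<in> A'" "a \<noteq> b" for a b
    proof
      assume "b \<in> span (insert a (span S))"
      then have "b \<in> cls a" by (simp add: span_S)
      then have "cls b \<subseteq> cls a"
        unfolding cls_def by (intro span_minimal) (auto intro: span_base)
      moreover have "dim (cls a) = dim (cls b)" using dim_cls[of a] dim_cls[of b] A'A ab(1,2) by (simp add: subsetD)
      ultimately have "cls b = cls a"
        by (intro subspace_dim_equal) (auto simp: cls_def)
      then show False using rep_A'[OF ab(1)] rep_A'[OF ab(2)] ab(3) by simp
    qed
    show "subspace H \<and> span S \<subseteq> H \<and> dim H = dim (span S) + 2" if "H \<in> \<H>" for H
      using \<H>(2)[OF that] by (simp add: dim_span span_minimal)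
    show "t \<le> real (card (A' \<inter> H))" if H: "H \<in> \<H>" for H
    proof -
      have sub: "A \<inter> H \<subseteq> (\<Union>a\<in>A' \<inter> H. P \<inter> cls a)"
      proof
        fix a assume a: "a \<in> A \<inter> H"
        let ?b = "rep (cls a)"
        have b: "?b \<in> A'" "cls ?b = cls a" using a rep by (auto simp: A'_def)
        have "cls a \<subseteq> H" unfolding cls_def using a \<H>(2)[OF H] by (intro span_minimal) auto
        moreover have "?b \<in> cls ?b" "a \<in> cls a" by (auto simp: cls_def intro: span_base)
        ultimately have "?b \<in> A' \<inter> H" "a \<in> P \<inter> cls ?b" using b a by (auto simp: A_def)
        then show "a \<in> (\<Union>a\<in>A' \<inter> H. P \<inter> cls a)" by blast
      qed
      have fin: "finite (A' \<inter> H)" using A'A finA finite_subset by blast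
      have "real (card (A \<inter> H)) \<le> real (card (\<Union>a\<in>A' \<inter> H. P \<inter> cls a))"
        using card_mono[OF _ sub] P fin by simp
      also have "\<dots> \<le> (\<Sum>a\<in>A' \<inter> H. B)"
        by (rule real_card_UN_le[OF fin]) (use A'A in \<open>auto simp: A_def cls_def\<close>)
      finally have "s / 4 \<le> real (card (A' \<inter> H)) * B" using rich[OF H] by simp
      then show ?thesis using B by (simp add: t_def field_simps)
    qed
  qed (use \<H> t in auto)
  also have "\<dots> \<le> 576 * (real (card P) ^ 2 / t ^ 3 + real (card P) / t)"
  proof -
    have "card A' \<le> card P" using A'A P by (intro card_mono) (auto simp: A_def)
    then show ?thesis
      using t by (intro mult_left_mono add_mono divide_right_mono power_mono) auto
  qed
  finally show ?thesis by (simp add: t_def)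
qed

text \<open>Averaging over the prefixes \<open>g\<close> of the light tuples: a prefix with fewer
  than \<open>r / 4\<close> extensions contributes less than \<open>r / 4\<close>, any other at most
  \<open>r\<close>. With \<open>r ^ Suc k / 2\<close> light tuples, at least
  \<open>r ^ k / 4\<close> prefixes are of the second kind.\<close>

lemma card_rich_tuples:
  fixes P H :: "'a::euclidean_space set" and B r :: real and k :: nat
  defines "A \<equiv> \<lambda>g. {a\<in>P. dim (insert a (g ` {..<k})) = Suc k \<and>
    real (card (P \<inter> span (insert a (g ` {..<k})))) \<le> B}"
  assumes P: "finite P" and r: "r = real (card (P \<inter> H))" "0 < r"
    and light: "r ^ Suc k / 2 \<le> real (card {f \<in> {..<Suc k} \<rightarrow>\<^sub>E P \<inter> H.
      dim (f ` {..<Suc k}) = Suc k \<and> real (card (P \<inter> span (f ` {..<Suc k}))) \<le> B})"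
  shows "r ^ k / 4 \<le> real (card {g \<in> {..<k} \<rightarrow>\<^sub>E P \<inter> H. r / 4 \<le> real (card (A g \<inter> H))})"
    (is "_ \<le> real (card ?G)")
proof -
  let ?L = "{f \<in> {..<Suc k} \<rightarrow>\<^sub>E P \<inter> H. dim (f ` {..<Suc k}) = Suc k \<and>
    real (card (P \<inter> span (f ` {..<Suc k}))) \<le> B}"
  let ?T = "{..<k} \<rightarrow>\<^sub>E P \<inter> H"
  let ?S = "SIGMA g:?T. A g \<inter> H"
  have fin: "finite ?T" "\<And>g. finite (A g \<inter> H)" using P by (auto simp: A_def intro!: finite_PiE)
  have "card ?L \<le> card ?S"
  proof (rule card_inj_on_le)
    show "(\<lambda>f. (restrict f {..<k}, f k)) ` ?L \<subseteq> ?S"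
    proof (rule image_subsetI)
      fix f assume f: "f \<in> ?L"
      have "insert (f k) (restrict f {..<k} ` {..<k}) = f ` {..<Suc k}"
        by (auto simp: lessThan_Suc)
      moreover have mem: "f i \<in> P \<inter> H" if "i < Suc k" for i
        using f that by (intro PiE_mem[of f "{..<Suc k}"]) simp_all
      then have "restrict f {..<k} \<in> ?T" by (simp add: restrict_PiE_iff)
      ultimately show "(restrict f {..<k}, f k) \<in> ?S"
        using f mem[of k] by (simp add: A_def)
    qed
    show "inj_on (\<lambda>f. (restrict f {..<k}, f k)) ?L"
    proof (rule inj_onI)
      fix f g assume *: "f \<in> ?L" "g \<in> ?L" "(restrict f {..<k}, f k) = (restrict g {..<k}, g k)"
      have "f i = g i" if "i < k" for i using *(3) that by (metis Pair_inject lessThan_iff restrict_apply')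
      then have "f i = g i" if "i \<in> {..<Suc k}" for i using that *(3) by (auto simp: less_Suc_eq)
      then show "f = g" using * by (auto intro: PiE_ext)
    qed
    show "finite ?S" by (rule finite_SigmaI[OF fin])
  qed
  then have "r ^ Suc k / 2 \<le> real (card ?S)" using light by linarith
  also have "\<dots> = (\<Sum>g\<in>?T. real (card (A g \<inter> H)))" using fin by (simp add: card_SigmaI)
  also have "\<dots> \<le> (\<Sum>g\<in>?T. r * of_bool (r / 4 \<le> real (card (A g \<inter> H))) + r / 4)"
  proof (rule sum_mono)
    fix g
    have "card (A g \<inter> H) \<le> card (P \<inter> H)" using P by (intro card_mono) (auto simp: A_def)
    then show "real (card (A g \<inter> H)) \<le> r * of_bool (r / 4 \<le> real (card (A g \<inter> H))) + r / 4"
      using r by (auto simp: of_bool_def)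
  qed
  also have "\<dots> = r * real (card ?G) + r ^ k * (r / 4)"
  proof -
    have "(\<Sum>g\<in>?T. of_bool (r / 4 \<le> real (card (A g \<inter> H)))) = real (card ?G)"
      using fin(1) by (simp add: of_bool_def sum.If_cases Int_def)
    then show ?thesis by (simp add: sum.distrib card_PiE r(1) flip: sum_distrib_left)
  qed
  finally have "r * (r ^ k / 4) \<le> r * real (card ?G)" by simp
  then show ?thesis using r(2) by (simp only: mult_le_cancel_left_pos)
qed

text \<open>Double counting of pairs of a flat and a \<open>k\<close>-tuple, where
  \<open>k = m - 2\<close>: a flat is related to at least \<open>s ^ k / 4\<close> tuples, a tuple
  to at most \<open>b\<close> flats. For \<open>m = 2\<close> the only tuple is empty, and the
  projection is from the zero space.\<close>

lemma flat_bound_step: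
  assumes m: "2 \<le> m" and fb: "\<forall>j. 2 \<le> j \<and> j < m \<longrightarrow> flat_bound TYPE('a::euclidean_space) \<gamma>\<^sub>0 C j"
    and \<gamma>0: "0 < \<gamma>\<^sub>0" "\<gamma>\<^sub>0 \<le> 1" and C: "0 \<le> C"
  shows "\<exists>\<gamma> C'. 0 < \<gamma> \<and> \<gamma> \<le> 1 \<and> 0 \<le> C' \<and> flat_bound TYPE('a) \<gamma> C' m"
proof -
  obtain k where k: "m = k + 2" using m le_Suc_ex by (metis add.commute)
  obtain \<gamma> B where \<gamma>: "0 < \<gamma>" "\<gamma> \<le> 1" and B: "1 \<le> B"
    and light: "\<And>(P :: 'a set) H. point_config P \<Longrightarrow> H \<in> flats P m \<Longrightarrow>
    nondeg \<gamma> P H \<Longrightarrow> 1 \<le> \<gamma> * real (card (P \<inter> H)) \<Longrightarrow>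
    real (card (P \<inter> H)) ^ (m - 1) / 2 \<le> real (card {f \<in> {..<m - 1} \<rightarrow>\<^sub>E P \<inter> H.
      dim (f ` {..<m - 1}) = m - 1 \<and> real (card (P \<inter> span (f ` {..<m - 1}))) \<le> B})"
  proof -
    from exists_light_tuples[OF m fb \<gamma>0 C] show thesis by (elim exE conjE) (rule that, auto)
  qed
  \<comment> \<open>Below \<open>S0\<close> the trivial bound \<open>n ^ m\<close> is enough. Above
    it, \<open>1 / \<gamma> \<le> s\<close> provides light tuples and \<open>8 * B \<le> s\<close>
    allows the projection.\<close>
  define S0 where "S0 = 1 / \<gamma> + 8 * B"
  \<comment> \<open>147456 = 4 * 576 * 64: the 4 comes from \<open>s ^ k / 4\<close>, the 64 from
    the cube of \<open>4 * B\<close>.\<close>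
  define C1 where "C1 = 147456 * B ^ 3"
  have S0: "0 < S0" using \<gamma> B by (simp add: S0_def add_pos_pos)
  have C1: "0 < C1" using B by (simp add: C1_def)
  have "real (card (rich_flats \<gamma> P m s)) \<le>
      (S0 ^ (m + 1) + C1) * (real (card P) ^ m / s ^ (m + 1) + real (card P) ^ (m - 1) / s ^ (m - 1))"
    if P: "point_config P" and s: "0 < s" for P :: "'a set" and s
  proof -
    define n where "n = real (card P)"
    define \<H> where "\<H> = rich_flats \<gamma> P m s"
    have n: "0 \<le> n" by (simp add: n_def)
    have finP: "finite P" by (rule point_config_finite[OF P])
    have fin\<H>: "finite \<H>"
      unfolding \<H>_def by (rule finite_subset[OF rich_flats_subset card_flats_le(1)[OF finP]])
    have nonneg: "0 \<le> n ^ m / s ^ (m + 1)" "0 \<le> n ^ (m - 1) / s ^ (m - 1)" using n s by auto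
    have "real (card \<H>) \<le> (S0 ^ (m + 1) + C1) * (n ^ m / s ^ (m + 1) + n ^ (m - 1) / s ^ (m - 1))"
    proof (cases "s < S0")
      case True
      have "card \<H> \<le> card (flats P m)"
        unfolding \<H>_def by (rule card_mono[OF card_flats_le(1)[OF finP] rich_flats_subset])
      also have "\<dots> \<le> card P ^ m" by (rule card_flats_le(2)[OF finP])
      finally have "real (card \<H>) \<le> n ^ m" by (simp add: n_def flip: of_nat_power)
      also have "\<dots> = s ^ (m + 1) * (n ^ m / s ^ (m + 1))" using s by simp
      also have "\<dots> \<le> S0 ^ (m + 1) * (n ^ m / s ^ (m + 1))"
        using True s nonneg by (intro mult_right_mono power_mono) auto
      also have "\<dots> \<le> (S0 ^ (m + 1) + C1) * (n ^ m / s ^ (m + 1) + n ^ (m - 1) / s ^ (m - 1))"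
        using nonneg S0 C1 by (intro mult_mono) auto
      finally show ?thesis .
    next
      case False
      then have s1: "1 / \<gamma> \<le> s" "8 * B \<le> s" using \<gamma> B unfolding S0_def
        by (smt (verit) zero_le_divide_1_iff)+
      define A where "A g = {a\<in>P. dim (insert a (g ` {..<k})) = Suc k \<and>
        real (card (P \<inter> span (insert a (g ` {..<k})))) \<le> B}" for g :: "nat \<Rightarrow> 'a"
      define rel where "rel g H \<longleftrightarrow> g ` {..<k} \<subseteq> H \<and> s / 4 \<le> real (card (A g \<inter> H))" for g H
      define G where "G = {..<k} \<rightarrow>\<^sub>E P"
      have finG: "finite G" using finP by (auto simp: G_def intro!: finite_PiE)
      have many: "s ^ k / 4 \<le> real (card {g\<in>G. rel g H})" if H: "H \<in> \<H>" for H
      proof -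
        define r where "r = real (card (P \<inter> H))"
        have H': "H \<in> flats P m" "nondeg \<gamma> P H" "s \<le> r"
          using H by (auto simp: \<H>_def rich_flats_def r_def)
        have "1 / \<gamma> \<le> r" using s1 H' by linarith
        then have "1 \<le> \<gamma> * r" using \<gamma> by (simp add: field_simps)
        have "0 < r" using H' s by linarith
        have "r ^ k / 4 \<le> real (card {g \<in> {..<k} \<rightarrow>\<^sub>E P \<inter> H. r / 4 \<le> real (card (A g \<inter> H))})"
          unfolding A_def
          by (rule card_rich_tuples[OF finP r_def \<open>0 < r\<close>])
            (use light[OF P H'(1,2)] \<open>1 \<le> \<gamma> * r\<close> in \<open>simp add: r_def k\<close>)
        also have "\<dots> \<le> real (card {g\<in>G. rel g H})"
        proof -
          have "{g \<in> {..<k} \<rightarrow>\<^sub>E P \<inter> H. r / 4 \<le> real (card (A g \<inter> H))} \<subseteq> {g\<in>G. rel g H}"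
          proof
            fix g assume g: "g \<in> {g \<in> {..<k} \<rightarrow>\<^sub>E P \<inter> H. r / 4 \<le> real (card (A g \<inter> H))}"
            then have mem: "g \<in> {..<k} \<rightarrow>\<^sub>E P \<inter> H" and "r / 4 \<le> real (card (A g \<inter> H))" by blast+
            moreover have "g \<in> G"
              using mem PiE_mono[of "{..<k}" "\<lambda>_. P \<inter> H" "\<lambda>_. P"] by (auto simp: G_def)
            moreover have "g ` {..<k} \<subseteq> H" using PiE_mem[OF mem] by blast
            ultimately show "g \<in> {g\<in>G. rel g H}" using H'(3) by (simp add: rel_def)
          qed
          then show ?thesis using finG by (intro of_nat_mono card_mono) auto
        qed
        finally have "r ^ k / 4 \<le> real (card {g\<in>G. rel g H})" .
        moreover have "s ^ k \<le> r ^ k" using H' s by (intro power_mono) auto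
        ultimately show ?thesis by linarith
      qed
      define b where "b = 576 * (n ^ 2 / (s / (4 * B)) ^ 3 + n / (s / (4 * B)))"
      have b0: "0 \<le> b" using n s B by (simp add: b_def)
      have few: "real (card {H\<in>\<H>. rel g H}) \<le> b" if g: "g \<in> G" for g
      proof (cases "dim (g ` {..<k}) = k")
        case True
        show ?thesis
          unfolding b_def n_def
        proof (rule card_rich_through[OF finP B s1(2), where S = "g ` {..<k}"])
          fix H assume "H \<in> {H\<in>\<H>. rel g H}"
          then have H: "H \<in> flats P m" "rel g H" by (auto simp: \<H>_def rich_flats_def)
          then show "subspace H \<and> g ` {..<k} \<subseteq> H \<and> dim H = dim (g ` {..<k}) + 2"
            using flats_subspace[OF H(1)] flatsD(2)[OF H(1)] True by (simp add: rel_def k)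
          show "s / 4 \<le> real (card ({a \<in> P. dim (insert a (g ` {..<k})) = Suc (dim (g ` {..<k})) \<and>
              real (card (P \<inter> span (insert a (g ` {..<k})))) \<le> B} \<inter> H))"
            using H(2) unfolding rel_def A_def True by simp
        qed (use fin\<H> in simp)
      next
        case False
        \<comment> \<open>A dependent prefix has no extension of rank \<open>k + 1\<close>, so it is
          related to no flat.\<close>
        have "A g = {}"
        proof -
          have "dim (g ` {..<k}) \<le> k"
            using dim_le_card'[of "g ` {..<k}"] card_image_le[of "{..<k}" g] by simp
          then have "dim (g ` {..<k}) < k" using False by simp
          then have "dim (insert a (g ` {..<k})) \<noteq> Suc k" for a
            using dim_insert[of a "g ` {..<k}"] by (auto split: if_splits)
          then show ?thesis by (auto simp: A_def)
        qed
        then have none: "{H\<in>\<H>. rel g H} = {}" using s by (auto simp: rel_def)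
        show ?thesis unfolding none using b0 by simp
      qed
      have "real (card \<H>) * (s ^ k / 4) \<le> (\<Sum>H\<in>\<H>. real (card {g\<in>G. rel g H}))"
        using sum_mono[of \<H> "\<lambda>_. s ^ k / 4", OF many] by simp
      also have "\<dots> = (\<Sum>g\<in>G. real (card {H\<in>\<H>. rel g H}))"
      proof -
        have "(\<Sum>H\<in>\<H>. real (card {g\<in>G. rel g H})) = (\<Sum>H\<in>\<H>. \<Sum>g\<in>G. of_bool (rel g H))"
          using finG by (simp add: of_bool_def sum.If_cases Int_def)
        also have "\<dots> = (\<Sum>g\<in>G. \<Sum>H\<in>\<H>. of_bool (rel g H))" by (rule sum.swap)
        also have "\<dots> = (\<Sum>g\<in>G. real (card {H\<in>\<H>. rel g H}))"
          using fin\<H> by (simp add: of_bool_def sum.If_cases Int_def)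
        finally show ?thesis .
      qed
      also have "\<dots> \<le> (\<Sum>g\<in>G. b)" by (rule sum_mono[OF few])
      also have "\<dots> = n ^ k * b" by (simp add: G_def card_PiE n_def)
      finally have main: "real (card \<H>) * s ^ k \<le> 4 * (n ^ k * b)" by simp
      have "real (card \<H>) \<le> 4 * (n ^ k * b) / s ^ k"
        using main s by (simp add: pos_le_divide_eq)
      also have "\<dots> \<le> C1 * (n ^ m / s ^ (m + 1) + n ^ (m - 1) / s ^ (m - 1))"
      proof -
        have "b \<le> (36864 * B ^ 3) * (n ^ 2 / s ^ 3 + n / s)"
        proof -
          have "B \<le> B ^ 3" using B by (simp add: self_le_power)
          then have "B * (n / s) \<le> B ^ 3 * (n / s)" using n s by (intro mult_right_mono) auto
          moreover have "0 \<le> B ^ 3 * (n / s)" using n s B by simp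
          ultimately have "2304 * (B * (n / s)) \<le> 36864 * (B ^ 3 * (n / s))" by linarith
          moreover have "b = 36864 * (B ^ 3 * (n ^ 2 / s ^ 3)) + 2304 * (B * (n / s))"
            using s B by (simp add: b_def power_divide power_mult_distrib mult.commute)
          ultimately show ?thesis by (simp add: distrib_left)
        qed
        then have "4 * (n ^ k * b) / s ^ k \<le> 4 * (n ^ k * ((36864 * B ^ 3) * (n ^ 2 / s ^ 3 + n / s))) / s ^ k"
          using n s by (intro divide_right_mono mult_left_mono) auto
        also have "\<dots> = C1 * (n ^ k * n ^ 2 / (s ^ k * s ^ 3) + n ^ k * n / (s ^ k * s))"
          using s by (simp add: C1_def field_simps)
        also have "\<dots> = C1 * (n ^ m / s ^ (m + 1) + n ^ (m - 1) / s ^ (m - 1))"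
          by (simp add: k power_add power2_eq_square power3_eq_cube mult.assoc mult.left_commute mult.commute)
        finally show ?thesis .
      qed
      also have "\<dots> \<le> (S0 ^ (m + 1) + C1) * (n ^ m / s ^ (m + 1) + n ^ (m - 1) / s ^ (m - 1))"
        using nonneg S0 by (intro mult_right_mono) auto
      finally show ?thesis .
    qed
    then show ?thesis by (simp add: \<H>_def n_def)
  qed
  then have "flat_bound TYPE('a) \<gamma> (S0 ^ (m + 1) + C1) m" by (simp add: flat_bound_def)
  moreover have "0 \<le> S0 ^ (m + 1) + C1" using S0 C1 by simp
  ultimately show ?thesis using \<gamma> by blast
qed

text \<open>Each rank brings its own constants; by \<open>flat_bound_mono\<close> the smallest
  \<gamma> and the largest \<open>C\<close> serve all ranks up to \<open>R\<close>.\<close>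

theorem nondegenerate_flats_bound:
  "\<exists>\<gamma> C. 0 < \<gamma> \<and> \<gamma> \<le> 1 \<and> 0 \<le> C \<and>
    (\<forall>j. 2 \<le> j \<longrightarrow> j \<le> R \<longrightarrow> flat_bound TYPE('a::euclidean_space) \<gamma> C j)"
proof (induction R)
  case 0
  show ?case by (rule exI[of _ 1], rule exI[of _ 0]) simp
next
  case (Suc R)
  then obtain \<gamma> C where IH: "0 < \<gamma>" "\<gamma> \<le> 1" "0 \<le> C"
    "\<And>j. 2 \<le> j \<Longrightarrow> j \<le> R \<Longrightarrow> flat_bound TYPE('a) \<gamma> C j" by blast
  show ?case
  proof (cases "2 \<le> Suc R")
    case False
    then show ?thesis using IH by (intro exI[of _ \<gamma>] exI[of _ C]) auto
  next
    case True
    obtain \<gamma>' C' where new: "0 < \<gamma>'" "\<gamma>' \<le> 1" "0 \<le> C'" "flat_bound TYPE('a) \<gamma>' C' (Suc R)"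
      using flat_bound_step[OF True _ IH(1-3)] IH(4) by (auto simp: less_Suc_eq_le)
    have "flat_bound TYPE('a) (min \<gamma> \<gamma>') (max C C') j" if "2 \<le> j" "j \<le> Suc R" for j
    proof (cases "j = Suc R")
      case True
      then show ?thesis using flat_bound_mono[OF new(4)] by simp
    next
      case False
      then show ?thesis using flat_bound_mono[OF IH(4)[of j]] that by simp
    qed
    then show ?thesis using IH(1-3) new(1-3)
      by (intro exI[of _ "min \<gamma> \<gamma>'"] exI[of _ "max C C'"]) auto
  qed
qed

section \<open>Cohyperplanar subsets\<close>

lemma card_scales_le:
  assumes "1 \<le> b"
  shows "real (card (scales a b)) \<le> ln b / ln 2"
proof -
  have "scales a b \<subseteq> {1..nat \<lfloor>log 2 b\<rfloor>}"
  proof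
    fix i assume "i \<in> scales a b"
    then have i: "1 \<le> i" "2 ^ i \<le> b" by (auto simp: scales_def)
    then have "2 powr real i \<le> b" by (simp add: powr_realpow)
    then have "real i \<le> log 2 b" using assms by (simp add: le_log_iff)
    then show "i \<in> {1..nat \<lfloor>log 2 b\<rfloor>}" using i by (simp add: le_nat_floor)
  qed
  then have "card (scales a b) \<le> card {1..nat \<lfloor>log 2 b\<rfloor>}" by (rule card_mono[rotated]) simp
  moreover have "0 \<le> log 2 b" using assms by simp
  ultimately have "real (card (scales a b)) \<le> log 2 b" by (simp add: le_nat_floor) linarith
  then show ?thesis by (simp add: log_def)
qed

text \<open>Injectivity gives the tuples rank at least 2, where the flat bounds start. The tuples
  are split by rank and then by scale.\<close>

lemma card_dependent_tuples:
  fixes C\<^sub>0 :: real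
  assumes D: "2 \<le> D"
  shows "\<exists>M\<ge>0. \<forall>(P :: 'a::euclidean_space set) l. point_config P \<longrightarrow> 2 \<le> l \<longrightarrow>
    real l \<le> C\<^sub>0 * sqrt (real (card P)) \<longrightarrow>
    (\<forall>F. subspace F \<longrightarrow> dim F \<le> D \<longrightarrow> card (P \<inter> F) \<le> l) \<longrightarrow>
    real (card {f \<in> {..<Suc D} \<rightarrow>\<^sub>E P. inj_on f {..<Suc D} \<and> dim (f ` {..<Suc D}) \<le> D})
      \<le> M * (real (card P) ^ D * ln (real l))"
proof -
  obtain \<gamma> C where \<gamma>: "0 < \<gamma>" "\<gamma> \<le> 1" and C: "0 \<le> C"
    and fb: "\<And>j. 2 \<le> j \<Longrightarrow> j \<le> D \<Longrightarrow> flat_bound TYPE('a) \<gamma> C j"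
    using nondegenerate_flats_bound[of D, where 'a = 'a] by blast
  define K where "K R = real R * (2 ^ Suc D * C * (2 / \<gamma> ^ R) ^ Suc D)" for R
  define M where "M = (\<Sum>R\<in>{2..D}. K R * ((1 + 2 * C\<^sub>0\<^sup>2) / ln 2))"
  have K: "0 \<le> K R" for R using C \<gamma> by (simp add: K_def)
  have "0 \<le> M" unfolding M_def using K by (intro sum_nonneg mult_nonneg_nonneg divide_nonneg_pos) auto
  moreover have "real (card {f \<in> {..<Suc D} \<rightarrow>\<^sub>E P. inj_on f {..<Suc D} \<and> dim (f ` {..<Suc D}) \<le> D})
      \<le> M * (real (card P) ^ D * ln (real l))"
    if P: "point_config P" and l: "2 \<le> l" "real l \<le> C\<^sub>0 * sqrt (real (card P))"
      and few: "\<And>F. subspace F \<Longrightarrow> dim F \<le> D \<Longrightarrow> card (P \<inter> F) \<le> l" for P :: "'a set" and l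
  proof -
    define n where "n = real (card P)"
    \<comment> \<open>A large \<open>C\<^sub>0\<close> lets \<open>l\<close> exceed
      \<open>n\<close>. The cut at \<open>n\<close> allows \<open>s ^ (D - R)\<close> to be replaced
      by \<open>n ^ (D - R)\<close>.\<close>
    define b where "b = min (real l) n"
    let ?T = "{f \<in> {..<Suc D} \<rightarrow>\<^sub>E P. inj_on f {..<Suc D} \<and> dim (f ` {..<Suc D}) \<le> D}"
    have finP: "finite P" by (rule point_config_finite[OF P])
    have "card P \<noteq> 0"
    proof
      assume "card P = 0"
      then show False using l by simp
    qed
    then have n: "1 \<le> n" by (simp add: n_def)
    have b: "1 \<le> b" "b \<le> real l" "b \<le> n" using l n by (auto simp: b_def)
    have lnl: "0 < ln (2::real)" "ln 2 \<le> ln (real l)" "ln b \<le> ln (real l)" using l b by auto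
    have "?T \<subseteq> (\<Union>R\<in>{2..D}. spanning_tuples P (Suc D) R 2 b)"
    proof
      fix f assume "f \<in> ?T"
      then have f: "f \<in> {..<Suc D} \<rightarrow>\<^sub>E P" "inj_on f {..<Suc D}" "dim (f ` {..<Suc D}) \<le> D" by blast+
      let ?X = "f ` {..<Suc D}"
      have X: "?X \<subseteq> P" using PiE_mem[OF f(1)] by blast
      have cX: "card ?X = Suc D" using f(2) by (simp add: card_image)
      have "2 \<le> dim ?X" using point_config_dim[OF P X] cX D by simp
      moreover have "card ?X \<le> card (P \<inter> span ?X)"
        using X finP by (intro card_mono) (auto intro: span_base)
      then have "2 \<le> card (P \<inter> span ?X)" using cX D by simp
      moreover have "real (card (P \<inter> span ?X)) \<le> b"
      proof -
        have "card (P \<inter> span ?X) \<le> l" using few[of "span ?X"] f(3) by (simp add: dim_span)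
        moreover have "card (P \<inter> span ?X) \<le> card P" using finP by (intro card_mono) auto
        ultimately show ?thesis by (simp add: b_def n_def)
      qed
      ultimately show "f \<in> (\<Union>R\<in>{2..D}. spanning_tuples P (Suc D) R 2 b)"
        using f(1,3) by (simp add: spanning_tuples_def)
    qed
    moreover have "finite (\<Union>R\<in>{2..D}. spanning_tuples P (Suc D) R 2 b)"
      unfolding spanning_tuples_def
      using finP by (intro finite_UN_I finite_subset[OF _ finite_PiE[of "{..<Suc D}" "\<lambda>_. P"]]) auto
    ultimately have "real (card ?T) \<le> real (card (\<Union>R\<in>{2..D}. spanning_tuples P (Suc D) R 2 b))"
      by (intro of_nat_mono card_mono)
    also have "\<dots> \<le> (\<Sum>R\<in>{2..D}. K R * ((1 + 2 * C\<^sub>0\<^sup>2) / ln 2) * (n ^ D * ln (real l)))"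
    proof (rule real_card_UN_le)
      fix R assume "R \<in> {2..D}"
      then have R: "2 \<le> R" "R \<le> D" by auto
      let ?S = "scales (\<gamma> ^ R * 2) b"
      have "real (card (spanning_tuples P (Suc D) R 2 b)) \<le>
        K R * (\<Sum>i\<in>?S. (2 ^ i) ^ (Suc D - R) * (n ^ R / 2 ^ i + n ^ (R - 1) * 2 ^ i))"
        unfolding K_def n_def
        by (rule card_spanning_tuples[OF fb \<gamma> C P]) (use R in auto)
      also have "(\<Sum>i\<in>?S. (2 ^ i) ^ (Suc D - R) * (n ^ R / 2 ^ i + n ^ (R - 1) * 2 ^ i)) \<le>
        (\<Sum>i\<in>?S. n ^ D + n ^ (D - 1) * (b * 2 ^ i))"
      proof (rule sum_mono)
        fix i assume "i \<in> ?S"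
        define s :: real where "s = 2 ^ i"
        have s: "0 < s" "s \<le> b" using \<open>i \<in> ?S\<close> by (auto simp: scales_def s_def)
        have "s ^ (Suc D - R) * (n ^ R / s + n ^ (R - 1) * s) = s ^ (D - R) * (n ^ R + n ^ (R - 1) * (s * s))"
          using s R by (simp add: Suc_diff_le field_simps)
        also have "\<dots> \<le> n ^ (D - R) * (n ^ R + n ^ (R - 1) * (b * s))"
          using s b n by (intro mult_mono power_mono add_mono mult_left_mono mult_right_mono) auto
        also have "\<dots> = n ^ D + n ^ (D - 1) * (b * s)"
        proof -
          have "n ^ (D - R) * n ^ R = n ^ D" "n ^ (D - R) * n ^ (R - 1) = n ^ (D - 1)"
            using R by (simp_all flip: power_add)
          then show ?thesis by (simp add: distrib_left mult.assoc[symmetric])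
        qed
        finally show "(2 ^ i) ^ (Suc D - R) * (n ^ R / 2 ^ i + n ^ (R - 1) * 2 ^ i) \<le>
          n ^ D + n ^ (D - 1) * (b * 2 ^ i)" by (simp add: s_def)
      qed
      also have "\<dots> = n ^ D * real (card ?S) + n ^ (D - 1) * (b * (\<Sum>i\<in>?S. 2 ^ i))"
        by (simp add: sum.distrib sum_distrib_left)
      also have "\<dots> \<le> n ^ D * (ln (real l) / ln 2) + n ^ (D - 1) * (n * (2 * C\<^sub>0\<^sup>2))"
      proof (intro add_mono mult_left_mono)
        show "real (card ?S) \<le> ln (real l) / ln 2"
          using card_scales_le[OF b(1), of "\<gamma> ^ R * 2"] lnl
          by (meson divide_right_mono less_imp_le order_trans)
        have "b * (\<Sum>i\<in>?S. 2 ^ i) \<le> b * (2 * b)"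
          using b sum_scales_power[of b] by (intro mult_left_mono) auto
        also have "\<dots> = 2 * b\<^sup>2" by (simp add: power2_eq_square)
        also have "b\<^sup>2 \<le> (C\<^sub>0 * sqrt n)\<^sup>2" using b l by (intro power_mono) (auto simp: n_def)
        also have "\<dots> = C\<^sub>0\<^sup>2 * n" using n by (simp add: power_mult_distrib)
        finally show "b * (\<Sum>i\<in>?S. 2 ^ i) \<le> n * (2 * C\<^sub>0\<^sup>2)" by (simp add: mult.commute mult.left_commute)
      qed (use n in auto)
      also have "n ^ (D - 1) * (n * (2 * C\<^sub>0\<^sup>2)) = n ^ D * (2 * C\<^sub>0\<^sup>2)"
        using D by (cases D) auto
      also have "n ^ D * (ln (real l) / ln 2) + n ^ D * (2 * C\<^sub>0\<^sup>2) \<le>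
        n ^ D * (ln (real l) / ln 2) + n ^ D * (2 * C\<^sub>0\<^sup>2 * (ln (real l) / ln 2))"
      proof -
        \<comment> \<open>As \<open>l\<close> is at least 2, the logarithm absorbs the contribution
          of the second term.\<close>
        have "1 \<le> ln (real l) / ln 2" using lnl by (simp add: le_divide_eq)
        then have "2 * C\<^sub>0\<^sup>2 * 1 \<le> 2 * C\<^sub>0\<^sup>2 * (ln (real l) / ln 2)" by (intro mult_left_mono) auto
        then show ?thesis using n by (intro add_left_mono mult_left_mono) auto
      qed
      also have "\<dots> = (1 + 2 * C\<^sub>0\<^sup>2) / ln 2 * (n ^ D * ln (real l))"
        by (simp add: field_simps)
      finally show "real (card (spanning_tuples P (Suc D) R 2 b)) \<le>
          K R * ((1 + 2 * C\<^sub>0\<^sup>2) / ln 2) * (n ^ D * ln (real l))"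
        using K[of R] by (simp add: mult.assoc mult_left_mono)
    qed simp
    also have "\<dots> = M * (n ^ D * ln (real l))" by (simp add: M_def sum_distrib_right)
    finally show ?thesis by (simp add: n_def)
  qed
  ultimately show ?thesis by blast
qed

section \<open>The alteration method for uniform hypergraphs\<close>

text \<open>The weights of \<open>expect\<close> sum to 1, which is \<open>expect_superset\<close>
  for the empty set, so the maximum of \<open>f\<close> is at least its expectation.\<close>

lemma exists_ge_expect:
  assumes "finite V" "0 \<le> p" "p \<le> 1"
  shows "\<exists>S\<subseteq>V. expect V p f \<le> f S"
proof -
  define m where "m = Max (f ` Pow V)"
  have fin: "finite (f ` Pow V)" using assms(1) by simp
  have "expect V p f \<le> expect V p (\<lambda>S. m * of_bool ({} \<subseteq> S))"
    using assms fin by (intro expect_mono) (auto simp: m_def)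
  also have "\<dots> = m * expect V p (\<lambda>S. of_bool ({} \<subseteq> S))" by (rule expect_mult)
  also have "\<dots> = m" using expect_superset[OF assms(1), of "{}" p] by simp
  finally have "expect V p f \<le> m" .
  moreover have "m \<in> f ` Pow V" unfolding m_def by (rule Max_in[OF fin]) auto
  ultimately show ?thesis by auto
qed

text \<open>Some \<open>S\<close> has \<open>card S\<close> minus the number of members of \<B>
  inside \<open>S\<close> at least as large as expected. Deleting one point of each such member
  costs no more than their number.\<close>

lemma exists_independent_subset:
  assumes V: "finite V" and p: "0 \<le> p" "p \<le> 1"
    and \<B>: "\<And>T. T \<in> \<B> \<Longrightarrow> T \<subseteq> V \<and> card T = Suc k"
  shows "\<exists>S\<subseteq>V. (\<forall>T\<in>\<B>. \<not> T \<subseteq> S) \<and> real (card V) * p - real (card \<B>) * p ^ Suc k \<le> real (card S)"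
proof -
  have fin\<B>: "finite \<B>" by (rule finite_subset[of _ "Pow V"]) (use \<B> V in auto)
  obtain S where S: "S \<subseteq> V" "expect V p (\<lambda>S. real (card S) + (- 1) * real (card {T\<in>\<B>. T \<subseteq> S}))
      \<le> real (card S) + (- 1) * real (card {T\<in>\<B>. T \<subseteq> S})"
    using exists_ge_expect[OF V p] by blast
  have "expect V p (\<lambda>S. real (card S) + (- 1) * real (card {T\<in>\<B>. T \<subseteq> S})) =
      real (card V) * p - real (card \<B>) * p ^ Suc k"
    unfolding expect_add expect_mult expect_card[OF V]
    using expect_card_superset[OF V fin\<B>, of "\<lambda>T. T" "Suc k" p] \<B> by simp
  with S have low: "real (card V) * p - real (card \<B>) * p ^ Suc k \<le>
      real (card S) - real (card {T\<in>\<B>. T \<subseteq> S})" by simp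
  define pick where "pick T = (SOME x. x \<in> T)" for T :: "'a set"
  have pick: "pick T \<in> T" if "T \<in> \<B>" for T
    using \<B>[OF that] some_in_eq[of T] by (auto simp: pick_def)
  define S' where "S' = S - pick ` {T\<in>\<B>. T \<subseteq> S}"
  have finS: "finite S" using S V finite_subset by blast
  have "\<not> T \<subseteq> S'" if "T \<in> \<B>" for T using pick[OF that] that by (auto simp: S'_def)
  moreover have "card S \<le> card S' + card {T\<in>\<B>. T \<subseteq> S}"
  proof -
    have "card S - card (pick ` {T\<in>\<B>. T \<subseteq> S}) \<le> card S'"
      unfolding S'_def using fin\<B> by (intro diff_card_le_card_Diff) auto
    moreover have "card (pick ` {T\<in>\<B>. T \<subseteq> S}) \<le> card {T\<in>\<B>. T \<subseteq> S}"
      using fin\<B> by (intro card_image_le) auto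
    ultimately show ?thesis by linarith
  qed
  ultimately show ?thesis using low S by (intro exI[of _ S']) (auto simp: S'_def)
qed

section \<open>Homogeneous coordinates\<close>

definition lift :: "'a \<Rightarrow> real \<times> 'a" where
  "lift x = (1, x)"

lemma inj_lift: "inj_on lift A"
  by (rule inj_onI) (simp add: lift_def)

lemma point_config_lift:
  assumes "finite (P :: 'a::euclidean_space set)"
  shows "point_config (lift ` P)"
  unfolding point_config_def
proof (intro conjI ballI impI)
  show "0 \<notin> lift ` P" by (auto simp: lift_def zero_prod_def)
next
  fix x y :: "real \<times> 'a" assume "x \<in> lift ` P" "y \<in> lift ` P" "x \<noteq> y"
  then show "y \<notin> span {x}" by (auto simp: lift_def span_singleton)
qed (use assms in simp)

lemma dim_lift_hyperplane:
  fixes H T :: "(real ^ 'd) set"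
  assumes "hyperplane H" "T \<subseteq> H"
  shows "dim (lift ` T) \<le> CARD('d)"
proof -
  obtain a b where ab: "a \<noteq> 0" "H = {x. a \<bullet> x = b}" using assms(1) by (auto simp: hyperplane_def)
  have "lift ` T \<subseteq> {z. (- b, a) \<bullet> z = 0}" using assms(2) ab(2) by (auto simp: lift_def)
  then have "dim (lift ` T) \<le> dim {z. (- b, a) \<bullet> z = 0}" by (rule dim_subset)
  also have "\<dots> = CARD('d)" using ab(1) by (subst dim_hyperplane) (auto simp: zero_prod_def)
  finally show ?thesis .
qed

text \<open>The space has dimension d + 1, so \<open>F\<close> lies in a linear hyperplane with some
  normal \<open>(\<beta>, a)\<close>; on lifted points this is the affine hyperplane
  \<open>a \<bullet> x = - \<beta>\<close>.\<close>

lemma card_lift_subspace: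
  fixes P :: "(real ^ 'd) set"
  assumes finP: "finite P" and P: "at_most_cohyperplanar l P" and F: "dim F \<le> CARD('d)"
  shows "card (lift ` P \<inter> F) \<le> l"
proof -
  have "dim F < DIM(real \<times> (real ^ 'd))" using F by simp
  from lowdim_subset_hyperplane[OF this]
  obtain w where w: "w \<noteq> 0" "span F \<subseteq> {x. w \<bullet> x = 0}" by blast
  obtain \<beta> a where wa: "w = (\<beta>, a)" by (cases w)
  have F0: "\<beta> + a \<bullet> x = 0" if "lift x \<in> F" for x
    using w(2) span_base[OF that] by (auto simp: wa lift_def)
  show ?thesis
  proof (cases "a = 0")
    \<comment> \<open>The hyperplane at infinity, which contains no lifted point.\<close>
    case True
    then have "lift ` P \<inter> F = {}" using F0 w(1) by (auto simp: wa zero_prod_def)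
    then show ?thesis by simp
  next
    case False
    have hyp: "hyperplane {x. a \<bullet> x = - \<beta>}" using False by (auto simp: hyperplane_def)
    have eq: "lift ` P \<inter> F = lift ` {x\<in>P. lift x \<in> F}" by auto
    have "card {x\<in>P. lift x \<in> F} \<le> card (P \<inter> {x. a \<bullet> x = - \<beta>})"
      by (rule card_mono) (use F0 finP in \<open>auto simp: eq_neg_iff_add_eq_0 add.commute\<close>)
    then show ?thesis
      using P hyp unfolding eq card_image[OF inj_lift] at_most_cohyperplanar_def
      by (meson order_trans)
  qed
qed

text \<open>Each subset is sent to one enumeration of its lift, an injection into the dependent
  tuples; the factor (d + 1)! is given away.\<close>

lemma card_cohyperplanar_subsets:
  fixes C\<^sub>0 :: real
  assumes D: "2 \<le> CARD('d)"
  shows "\<exists>M\<ge>0. \<forall>(P :: (real ^ 'd) set) l. finite P \<longrightarrow> 2 \<le> l \<longrightarrow>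
    real l \<le> C\<^sub>0 * sqrt (real (card P)) \<longrightarrow> at_most_cohyperplanar l P \<longrightarrow>
    real (card {T. T \<subseteq> P \<and> card T = Suc CARD('d) \<and> (\<exists>H. hyperplane H \<and> T \<subseteq> H)})
      \<le> M * (real (card P) ^ CARD('d) * ln (real l))"
proof -
  let ?I = "{..<Suc CARD('d)}"
  obtain M where M: "0 \<le> M" and bound: "\<And>(P :: (real \<times> (real ^ 'd)) set) l. point_config P \<Longrightarrow> 2 \<le> l \<Longrightarrow>
    real l \<le> C\<^sub>0 * sqrt (real (card P)) \<Longrightarrow>
    (\<And>F. subspace F \<Longrightarrow> dim F \<le> CARD('d) \<Longrightarrow> card (P \<inter> F) \<le> l) \<Longrightarrow>
    real (card {f \<in> ?I \<rightarrow>\<^sub>E P. inj_on f ?I \<and> dim (f ` ?I) \<le> CARD('d)})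
      \<le> M * (real (card P) ^ CARD('d) * ln (real l))"
    using card_dependent_tuples[OF D, of C\<^sub>0, where 'a = "real \<times> (real ^ 'd)"] by auto
  have "real (card {T. T \<subseteq> P \<and> card T = Suc CARD('d) \<and> (\<exists>H. hyperplane H \<and> T \<subseteq> H)})
      \<le> M * (real (card P) ^ CARD('d) * ln (real l))"
    if P: "finite P" and l: "2 \<le> l" "real l \<le> C\<^sub>0 * sqrt (real (card P))"
      and co: "at_most_cohyperplanar l P" for P :: "(real ^ 'd) set" and l
  proof -
    let ?B = "{T. T \<subseteq> P \<and> card T = Suc CARD('d) \<and> (\<exists>H. hyperplane H \<and> T \<subseteq> H)}"
    let ?F = "{f \<in> ?I \<rightarrow>\<^sub>E lift ` P. inj_on f ?I \<and> dim (f ` ?I) \<le> CARD('d)}"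
    have "\<exists>f. f \<in> ?F \<and> f ` ?I = lift ` T" if T: "T \<in> ?B" for T
    proof -
      have "T \<subseteq> P" "card T = Suc CARD('d)" "finite T"
        using T P finite_subset by auto
      obtain H where H: "hyperplane H" "T \<subseteq> H" using T by auto
      have "finite (lift ` T)" "card (lift ` T) = Suc CARD('d)"
        using \<open>finite T\<close> \<open>card T = _\<close> by (simp_all add: card_image[OF inj_lift])
      then obtain h where h: "bij_betw h ?I (lift ` T)"
        using ex_bij_betw_nat_finite[of "lift ` T"] by (auto simp: atLeast0LessThan)
      have "inj_on (restrict h ?I) ?I" using h by (simp add: bij_betw_def)
      moreover have im: "restrict h ?I ` ?I = lift ` T" using h by (simp add: bij_betw_def)
      moreover have "restrict h ?I \<in> ?I \<rightarrow>\<^sub>E lift ` P"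
      proof -
        have "h i \<in> lift ` P" if "i \<in> ?I" for i
          using bij_betw_apply[OF h that] \<open>T \<subseteq> P\<close> by blast
        then show ?thesis by (simp only: restrict_PiE_iff) blast
      qed
      moreover have "dim (restrict h ?I ` ?I) \<le> CARD('d)"
        unfolding im by (rule dim_lift_hyperplane[OF H])
      ultimately show ?thesis by blast
    qed
    then have "\<forall>T\<in>?B. \<exists>f. f \<in> ?F \<and> f ` ?I = lift ` T" by (rule ballI)
    from bchoice[OF this] obtain \<phi> where "\<forall>T\<in>?B. \<phi> T \<in> ?F \<and> \<phi> T ` ?I = lift ` T" ..
    then have \<phi>: "\<phi> T \<in> ?F \<and> \<phi> T ` ?I = lift ` T" if "T \<in> ?B" for T
      using that by (rule bspec)
    have "inj_on \<phi> ?B"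
    proof (rule inj_onI)
      fix S T assume ST: "S \<in> ?B" "T \<in> ?B" "\<phi> S = \<phi> T"
      then have "lift ` S = lift ` T" using \<phi>[OF ST(1)] \<phi>[OF ST(2)] by simp
      then show "S = T" by (simp only: inj_image_eq_iff[OF inj_lift])
    qed
    moreover have "\<phi> ` ?B \<subseteq> ?F" by (rule image_subsetI, rule conjunct1, rule \<phi>)
    moreover have "finite ?F" using P by (intro finite_subset[OF _ finite_PiE[of ?I "\<lambda>_. lift ` P"]]) auto
    ultimately have "card ?B \<le> card ?F" by (rule card_inj_on_le)
    then have "real (card ?B) \<le> real (card ?F)" by simp
    also have "\<dots> \<le> M * (real (card (lift ` P)) ^ CARD('d) * ln (real l))"
    proof (rule bound[OF point_config_lift[OF P] l(1)])
      show "real l \<le> C\<^sub>0 * sqrt (real (card (lift ` P)))" using l by (simp add: card_image[OF inj_lift])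
      show "card (lift ` P \<inter> F) \<le> l" if "dim F \<le> CARD('d)" for F
        by (rule card_lift_subspace[OF P co that])
    qed
    finally show ?thesis by (simp add: card_image[OF inj_lift])
  qed
  then show ?thesis using M by blast
qed

section \<open>General position and the moment curve\<close>

lemma general_position_iff:
  fixes S :: "(real ^ 'd) set"
  assumes "finite S"
  shows "general_position S \<longleftrightarrow>
    (\<forall>T\<subseteq>S. card T = Suc CARD('d) \<longrightarrow> \<not> (\<exists>H. hyperplane H \<and> T \<subseteq> H))"
proof
  assume gp: "general_position S"
  show "\<forall>T\<subseteq>S. card T = Suc CARD('d) \<longrightarrow> \<not> (\<exists>H. hyperplane H \<and> T \<subseteq> H)"
  proof (intro allI impI notI, elim exE conjE)
    fix T H assume T: "T \<subseteq> S" "card T = Suc CARD('d)" "hyperplane H" "T \<subseteq> H"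
    then have "card T \<le> card (S \<inter> H)" using assms by (intro card_mono) auto
    also have "\<dots> \<le> CARD('d)" using gp T(3) by (simp add: general_position_def)
    finally show False using T(2) by simp
  qed
next
  assume no: "\<forall>T\<subseteq>S. card T = Suc CARD('d) \<longrightarrow> \<not> (\<exists>H. hyperplane H \<and> T \<subseteq> H)"
  show "general_position S"
    unfolding general_position_def
  proof (intro conjI allI impI assms, rule ccontr)
    fix H :: "(real ^ 'd) set" assume H: "hyperplane H" "\<not> card (S \<inter> H) \<le> CARD('d)"
    then have "Suc CARD('d) \<le> card (S \<inter> H)" by simp
    then obtain T where "T \<subseteq> S \<inter> H" "card T = Suc CARD('d)" by (rule obtain_subset_with_card_n)
    then show False using no H(1) by blast
  qed
qed

lemma general_position_subset:
  assumes "general_position S" "T \<subseteq> S"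
  shows "general_position T"
proof -
  have "finite S" using assms by (simp add: general_position_def)
  then show ?thesis
    using assms unfolding general_position_def
    by (meson Int_mono card_mono finite_Int finite_subset order_refl order_trans)
qed

text \<open>Points on the moment curve: a hyperplane meets it at the roots of a nonzero polynomial
  of degree at most d. Such a set shows that \<alpha> is a maximum over a bounded set of
  numbers.\<close>

lemma exists_general_position:
  "\<exists>S :: (real ^ 'd) set. card S = n \<and> general_position S"
proof -
  obtain idx :: "'d \<Rightarrow> nat" where idx: "bij_betw idx UNIV {0..<CARD('d)}"
    using ex_bij_betw_finite_nat[of "UNIV :: 'd set"] by auto
  define mc :: "real \<Rightarrow> real ^ 'd" where "mc t = (\<chi> i. t ^ Suc (idx i))" for t
  \<comment> \<open>This coordinate of \<open>mc t\<close> is \<open>t\<close> itself, which makes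
    the curve injective.\<close>
  obtain i0 where i0: "idx i0 = 0"
    using bij_betw_imp_surj_on[OF idx] zero_less_card_finite[where 'a = 'd]
    by (metis atLeastLessThan_iff imageE zero_le)
  have inj: "inj mc"
  proof (rule injI)
    fix s t assume "mc s = mc t"
    then have "mc s $ i0 = mc t $ i0" by simp
    then show "s = t" by (simp add: mc_def i0)
  qed
  define S where "S = (\<lambda>k. mc (real k)) ` {..<n}"
  have finS: "finite S" by (simp add: S_def)
  have "inj_on (\<lambda>k. mc (real k)) {..<n}"
    using inj by (auto intro!: inj_onI dest: injD)
  then have "card S = n" unfolding S_def by (subst card_image) auto
  moreover have "general_position S"
    unfolding general_position_def
  proof (intro conjI allI impI finS)
    fix H :: "(real ^ 'd) set" assume "hyperplane H"
    then obtain a b where ab: "a \<noteq> 0" "H = {x. a \<bullet> x = b}" by (auto simp: hyperplane_def)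
    define q where "q = (\<Sum>i\<in>UNIV. monom (a $ i) (Suc (idx i))) - [:b:]"
    have eval: "poly q t = a \<bullet> mc t - b" for t
      by (simp add: q_def poly_sum poly_monom inner_vec_def mc_def)
    have coeff: "coeff q (Suc (idx i)) = a $ i" for i
    proof -
      have "coeff q (Suc (idx i)) = (\<Sum>j\<in>UNIV. if j = i then a $ j else 0)"
        using bij_betw_imp_inj_on[OF idx]
        by (auto simp: q_def coeff_sum inj_eq intro!: sum.cong)
      then show ?thesis by simp
    qed
    obtain i where "a $ i \<noteq> 0" using ab(1) by (auto simp: vec_eq_iff)
    then have "q \<noteq> 0" using coeff[of i] by auto
    have "degree q \<le> CARD('d)"
      unfolding q_def
    proof (intro degree_diff_le degree_sum_le)
      fix i :: 'd
      have "idx i < CARD('d)" using bij_betw_apply[OF idx, of i] by simp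
      then show "degree (monom (a $ i) (Suc (idx i))) \<le> CARD('d)"
        by (meson Suc_leI degree_monom_le order_trans)
    qed auto
    have "S \<inter> H \<subseteq> mc ` {t. poly q t = 0}" by (auto simp: S_def ab(2) eval)
    then have "card (S \<inter> H) \<le> card (mc ` {t. poly q t = 0})"
      using poly_roots_finite[OF \<open>q \<noteq> 0\<close>] by (intro card_mono) auto
    also have "\<dots> \<le> card {t. poly q t = 0}"
      using poly_roots_finite[OF \<open>q \<noteq> 0\<close>] by (rule card_image_le)
    also have "\<dots> \<le> degree q" using \<open>q \<noteq> 0\<close> by (rule card_poly_roots_bound)
    finally show "card (S \<inter> H) \<le> CARD('d)" using \<open>degree q \<le> _\<close> by simp
  qed
  ultimately show ?thesis by blast
qed

section \<open>Large subsets in general position\<close>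

lemma exists_general_position_subset:
  fixes C :: real
  assumes D: "2 \<le> CARD('d)"
  shows "\<exists>c>0. \<forall>(P :: (real ^ 'd) set) l. finite P \<longrightarrow> P \<noteq> {} \<longrightarrow>
    real l \<le> C * sqrt (real (card P)) \<longrightarrow> at_most_cohyperplanar l P \<longrightarrow>
    (\<exists>S\<subseteq>P. general_position S \<and>
      c * (real (card P) / ln (real l)) powr (1 / real CARD('d)) \<le> real (card S))"
proof -
  obtain M where M: "0 \<le> M" and bound: "\<And>(P :: (real ^ 'd) set) l. finite P \<Longrightarrow> 2 \<le> l \<Longrightarrow>
    real l \<le> C * sqrt (real (card P)) \<Longrightarrow> at_most_cohyperplanar l P \<Longrightarrow>
    real (card {T. T \<subseteq> P \<and> card T = Suc CARD('d) \<and> (\<exists>H. hyperplane H \<and> T \<subseteq> H)})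
      \<le> M * (real (card P) ^ CARD('d) * ln (real l))"
    using card_cohyperplanar_subsets[OF D, of C] by auto
  \<comment> \<open>The bound \<open>ln 2\<close> helps to keep the probability \<open>p\<close> at
    most 1; the other one makes the expected number of bad subsets at most half of
    \<open>n * p\<close>.\<close>
  define c where "c = min (ln 2) (1 / (2 * (M + 1)))"
  have c: "0 < c" "c \<le> ln 2" "c < 1" using M ln_2_less_1 by (auto simp: c_def)
  have cM: "c ^ CARD('d) * M \<le> 1 / 2"
  proof -
    have "c ^ CARD('d) \<le> c ^ 1" using c D by (intro power_decreasing) auto
    also have "\<dots> \<le> 1 / (2 * (M + 1))" by (simp add: c_def)
    finally have "c ^ CARD('d) * M \<le> 1 / (2 * (M + 1)) * M" using M by (intro mult_right_mono)
    also have "\<dots> \<le> 1 / 2" using M by (simp add: field_simps)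
    finally show ?thesis .
  qed
  have "\<exists>S\<subseteq>P. general_position S \<and>
      c / 2 * (real (card P) / ln (real l)) powr (1 / real CARD('d)) \<le> real (card S)"
    if P: "finite P" "P \<noteq> {}" and l: "real l \<le> C * sqrt (real (card P))"
      and co: "at_most_cohyperplanar l P" for P :: "(real ^ 'd) set" and l
  proof (cases "2 \<le> l")
    case False
    \<comment> \<open>For \<open>l\<close> equal to 0 or 1 the logarithm is 0, and division by zero
      gives 0, so the claimed lower bound is 0 and the empty set will do.\<close>
    then have "ln (real l) = 0" by (cases l) auto
    then have "(real (card P) / ln (real l)) powr (1 / real CARD('d)) = 0" by simp
    moreover have "general_position ({} :: (real ^ 'd) set)" by (simp add: general_position_def)
    ultimately show ?thesis by (intro exI[of _ "{}"]) auto
  next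
    case True
    define n where "n = real (card P)"
    define x where "x = n / ln (real l)"
    define y where "y = x powr (1 / real CARD('d))"
    define p where "p = c * y / n"
    have "card P \<noteq> 0" using P by simp
    then have n: "1 \<le> n" by (simp add: n_def)
    have lnl: "ln 2 \<le> ln (real l)" "0 < ln (real l)" using True by auto
    have x: "0 < x" using n lnl by (simp add: x_def)
    have y: "0 < y" using x by (simp add: y_def)
    have y_pow: "y ^ CARD('d) = x"
      using x by (simp add: y_def powr_powr flip: powr_realpow)
    \<comment> \<open>That is, \<open>p \<le> 1\<close>. For \<open>x \<ge> 1\<close> the root
      \<open>y\<close> is at most \<open>x\<close>, which is at most \<open>n / ln 2\<close>; for
      smaller \<open>x\<close> it is at most 1.\<close>
    have "c * y \<le> n"
    proof (cases "1 \<le> x")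
      case True
      have "y \<le> x powr 1" unfolding y_def using True D by (intro powr_mono) auto
      also have "\<dots> = x" using x by simp
      also have "\<dots> \<le> n / ln 2" unfolding x_def using n lnl by (intro divide_left_mono) auto
      finally have "c * y \<le> ln 2 * (n / ln 2)" using c y by (intro mult_mono) auto
      then show ?thesis by simp
    next
      case False
      then have "y \<le> 1" unfolding y_def using x by (intro powr_le1) auto
      then have "c * y \<le> 1 * 1" using c y by (intro mult_mono) auto
      then show ?thesis using n by simp
    qed
    then have p: "0 \<le> p" "p \<le> 1" using c y n by (auto simp: p_def)
    have np: "n * p = c * y" using n by (simp add: p_def)
    let ?B = "{T. T \<subseteq> P \<and> card T = Suc CARD('d) \<and> (\<exists>H. hyperplane H \<and> T \<subseteq> H)}"
    obtain S where S: "S \<subseteq> P" "\<forall>T\<in>?B. \<not> T \<subseteq> S"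
      "n * p - real (card ?B) * p ^ Suc CARD('d) \<le> real (card S)"
      using exists_independent_subset[OF P(1) p, of ?B "CARD('d)"] unfolding n_def by blast
    have "real (card ?B) * p ^ Suc CARD('d) \<le> M * (n ^ CARD('d) * ln (real l)) * p ^ Suc CARD('d)"
      using bound[OF P(1) True l co] p by (intro mult_right_mono) (auto simp: n_def)
    also have "\<dots> = M * ln (real l) * p * (n * p) ^ CARD('d)"
      by (simp add: power_mult_distrib)
    also have "\<dots> = M * ln (real l) * p * (c ^ CARD('d) * x)"
      by (simp add: np power_mult_distrib y_pow)
    also have "\<dots> = c ^ CARD('d) * M * (n * p)" using lnl by (simp add: x_def)
    also have "\<dots> \<le> 1 / 2 * (n * p)" using cM p n by (intro mult_right_mono) auto
    finally have "c / 2 * y \<le> real (card S)" using S(3) np by simp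
    moreover have "general_position S"
    proof -
      have "finite S" using S(1) P(1) finite_subset by blast
      then show ?thesis using S(1,2) by (subst general_position_iff) blast+
    qed
    ultimately show ?thesis using S(1) by (auto simp: y_def x_def n_def)
  qed
  then show ?thesis using c by (intro exI[of _ "c / 2"]) auto
qed

text \<open>\<open>GREATEST\<close> is meaningful only if the qualifying numbers are bounded. Here
  \<open>n\<close> bounds them, because an admissible \<open>P\<close> exists: as \<open>l\<close>
  is at least d, any \<open>n\<close> points in general position form one.\<close>

lemma alpha_ge:
  assumes l: "CARD('d::finite) \<le> l"
    and sub: "\<And>P :: (real ^ 'd) set. finite P \<Longrightarrow> card P = n \<Longrightarrow> at_most_cohyperplanar l P \<Longrightarrow>
      \<exists>S\<subseteq>P. general_position S \<and> k \<le> card S"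
  shows "k \<le> alpha n TYPE('d) l"
  unfolding alpha_def
proof (rule Greatest_le_nat[where b = n])
  show "\<forall>P :: (real ^ 'd) set. finite P \<and> card P = n \<and> at_most_cohyperplanar l P \<longrightarrow>
      (\<exists>S\<subseteq>P. card S = k \<and> general_position S)"
  proof (intro allI impI, elim conjE)
    fix P :: "(real ^ 'd) set"
    assume "finite P" "card P = n" "at_most_cohyperplanar l P"
    then obtain S where S: "S \<subseteq> P" "general_position S" "k \<le> card S" using sub by blast
    obtain T where "T \<subseteq> S" "card T = k" using obtain_subset_with_card_n[OF S(3)] by blast
    then show "\<exists>S\<subseteq>P. card S = k \<and> general_position S"
      using S general_position_subset by blast
  qed
next
  fix k' assume k': "\<forall>P :: (real ^ 'd) set. finite P \<and> card P = n \<and> at_most_cohyperplanar l P \<longrightarrow>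
      (\<exists>S\<subseteq>P. card S = k' \<and> general_position S)"
  obtain P :: "(real ^ 'd) set" where P: "card P = n" "general_position P"
    using exists_general_position by blast
  then have "finite P" "at_most_cohyperplanar l P"
    using l by (auto simp: general_position_def at_most_cohyperplanar_def intro: order_trans)
  then obtain S where "S \<subseteq> P" "card S = k'" using k' P(1) by blast
  then show "k' \<le> n" using card_mono[OF \<open>finite P\<close>] P(1) by blast
qed

theorem theorem10:
  fixes C :: real
  assumes "CARD('d::finite) \<ge> 2" and "C > 0"
  shows "\<exists>c>0. \<exists>N. \<forall>n\<ge>N. \<forall>l::nat. real l \<le> C * sqrt (real n) \<longrightarrow>
    (\<forall>P :: (real ^ 'd) set. finite P \<and> card P = n \<and> at_most_cohyperplanar l P \<longrightarrow>
       (\<exists>S\<subseteq>P. general_position S \<and>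
          c * (real n / ln (real l)) powr (1 / real CARD('d)) \<le> real (card S))) \<and>
    (CARD('d) \<le> l \<longrightarrow>
       c * (real n / ln (real l)) powr (1 / real CARD('d)) \<le> real (alpha n TYPE('d) l))"
proof -
  obtain c where c: "0 < c" and main: "\<And>(P :: (real ^ 'd) set) l. finite P \<Longrightarrow> P \<noteq> {} \<Longrightarrow>
    real l \<le> C * sqrt (real (card P)) \<Longrightarrow> at_most_cohyperplanar l P \<Longrightarrow>
    \<exists>S\<subseteq>P. general_position S \<and>
      c * (real (card P) / ln (real l)) powr (1 / real CARD('d)) \<le> real (card S)"
    using exists_general_position_subset[OF assms(1), of C] by blast
  have "(\<forall>P :: (real ^ 'd) set. finite P \<and> card P = n \<and> at_most_cohyperplanar l P \<longrightarrow>
       (\<exists>S\<subseteq>P. general_position S \<and>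
          c * (real n / ln (real l)) powr (1 / real CARD('d)) \<le> real (card S))) \<and>
    (CARD('d) \<le> l \<longrightarrow>
       c * (real n / ln (real l)) powr (1 / real CARD('d)) \<le> real (alpha n TYPE('d) l))"
    if n: "1 \<le> n" and l: "real l \<le> C * sqrt (real n)" for n l
  proof -
    define v where "v = c * (real n / ln (real l)) powr (1 / real CARD('d))"
    have sub: "\<exists>S\<subseteq>P. general_position S \<and> v \<le> real (card S)"
      if "finite P" "card P = n" "at_most_cohyperplanar l P" for P :: "(real ^ 'd) set"
    proof -
      have "P \<noteq> {}" using that(2) n by auto
      then show ?thesis
        using main[of P l] that l unfolding v_def by simp
    qed
    have "v \<le> real (alpha n TYPE('d) l)" if "CARD('d) \<le> l"
    proof -
      \<comment> \<open>Cardinalities are integers, so the real bound may be rounded up before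
        \<open>alpha_ge\<close> is applied.\<close>
      have "nat \<lceil>v\<rceil> \<le> alpha n TYPE('d) l"
      proof (rule alpha_ge[OF that])
        fix P :: "(real ^ 'd) set"
        assume "finite P" "card P = n" "at_most_cohyperplanar l P"
        from sub[OF this] show "\<exists>S\<subseteq>P. general_position S \<and> nat \<lceil>v\<rceil> \<le> card S"
          by (auto simp: ceiling_le_iff nat_le_iff)
      qed
      then show ?thesis by linarith
    qed
    then show ?thesis using sub unfolding v_def by blast
  qed
  then show ?thesis using c by blast
qed

end
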